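(* In the setting of the context, assume that $\Psi\in\mathcal N^2(0,T;L_2^0)$. Then the process $$W^\Psi(t):=\int_0^t S(t-\tau)\Psi(\tau)\,dW(\tau),\qquad t\in[0,T],$$ has square integrable trajectories, i.e. $\int_0^T|W^\Psi(t)|_H^2\,dt<+\infty$ $P$-a.s.
   Context: $H$ and $U$ are separable (real) Hilbert spaces and $T>0$ is fixed. $(\Omega,\mathcal F,(\mathcal F_t)_{t\ge0},P)$ is a filtered probability space whose filtration is normal ($\mathcal F_0$ contains all $P$-null sets of $\mathcal F$, and $\mathcal F_t=\bigcap_{s>t}\mathcal F_s$). $W$ is a cylindrical Wiener process with respect to $(\mathcal F_t)$ with nonnegative covariance operator $Q\in L(U)$ ($\mathrm{Tr}\,Q<\infty$ is not assumed). There is a complete orthonormal set $\{e_k\}\subset U$ of eigenvectors of $Q$ with eigenvalues $\lambda_k$, and $W(t)=\sum_k e_k\beta_k(t)$ with independent real Wiener processes $\beta_k$, $\mathbb E\beta_k^2(t)=\lambda_k t$. $U_0:=Q^{1/2}(U)$ with inner product $\langle u,v\rangle_{U_0}=\langle Q^{-1/2}u,Q^{-1/2}v\rangle_U$. $L_2^0:=L_2(U_0,H)$ is the space of Hilbert-Schmidt operators from $U_0$ to $H$ with the Hilbert-Schmidt norm. $\mathcal N^2(0,T;L_2^0)$ is the space of $L_2^0$-valued predictable processes $\Phi$ on $[0,T]$ with $\mathbb E\int_0^T|\Phi(\tau)|_{L_2^0}^2d\tau<\infty$. Stochastic integrals are the usual Hilbert-space stochastic integrals with respect to the cylindrical Wiener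 process $W$; $W^\Psi$ is taken in its predictable version. Volterra assumptions: $A:D(A)\subset H\to H$ is a closed, densely defined unbounded linear operator; $a\in L^1_{\mathrm{loc}}(\mathbb R_+)$; and the deterministic Volterra equation $X(t)=X_0+\int_0^t a(t-\tau)AX(\tau)\,d\tau+f(t)$ is well-posed, i.e. it admits a resolvent $(S(t))_{t\ge0}$: a family of bounded linear operators on $H$ such that (1) $S$ is strongly continuous on $\mathbb R_+$ and $S(0)=I$; (2) $S(t)D(A)\subset D(A)$ and $AS(t)x=S(t)Ax$ for $x\in D(A)$, $t\ge0$; (3) $S(t)x=x+\int_0^t a(t-\tau)AS(\tau)x\,d\tau$ for all $x\in D(A)$, $t\ge0$. *)

theory Defs
  imports "HOL-Probability.Probability"
begin

text \<open>
  A separable real Hilbert space is a type of sort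
  \<open>{real_inner, banach, second_countable_topology}\<close>.
\<close>

section \<open>Linear operators and Hilbert--Schmidt operators\<close>

definition linear_on :: "'a::real_vector set \<Rightarrow> ('a \<Rightarrow> 'b::real_vector) \<Rightarrow> bool" where
  "linear_on V L \<longleftrightarrow>
     (\<forall>x\<in>V. \<forall>y\<in>V. L (x + y) = L x + L y) \<and> (\<forall>c. \<forall>x\<in>V. L (c *\<^sub>R x) = c *\<^sub>R L x)"

text \<open>Below, \<open>V\<close> is a linear subspace carrying an inner product \<open>ip\<close> of its own, in general
  different from the one of the ambient type.\<close>

definition orthonormal_basis :: "'a::real_vector set \<Rightarrow> ('a \<Rightarrow> 'a \<Rightarrow> real) \<Rightarrow> 'a set \<Rightarrow> bool" where
  "orthonormal_basis V ip G \<longleftrightarrow>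
     G \<subseteq> V \<and> (\<forall>g\<in>G. \<forall>h\<in>G. ip g h = (if g = h then 1 else 0)) \<and>
     (\<forall>v\<in>V. (\<forall>g\<in>G. ip v g = 0) \<longrightarrow> v = 0)"

text \<open>The Hilbert--Schmidt property and norm do not depend on the orthonormal basis, so any
  fixed one may be used.\<close>

definition some_basis :: "'a::real_vector set \<Rightarrow> ('a \<Rightarrow> 'a \<Rightarrow> real) \<Rightarrow> 'a set" where
  "some_basis V ip = (SOME G. orthonormal_basis V ip G)"

text \<open>Operators with domain \<open>V\<close> are functions that are \<open>undefined\<close> outside \<open>V\<close>, so that
  equality of functions is equality of operators.\<close>

definition hs_operators ::
    "'a::real_vector set \<Rightarrow> ('a \<Rightarrow> 'a \<Rightarrow> real) \<Rightarrow> ('a \<Rightarrow> 'b::real_normed_vector) set" where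
  "hs_operators V ip =
     {B \<in> extensional V. linear_on V B \<and> (\<exists>C. \<forall>v\<in>V. norm (B v) \<le> C * sqrt (ip v v)) \<and>
        (\<lambda>g. (norm (B g))\<^sup>2) summable_on some_basis V ip}"

definition hs_norm ::
    "'a::real_vector set \<Rightarrow> ('a \<Rightarrow> 'a \<Rightarrow> real) \<Rightarrow> ('a \<Rightarrow> 'b::real_normed_vector) \<Rightarrow> real" where
  "hs_norm V ip B = sqrt (\<Sum>\<^sub>\<infinity>g\<in>some_basis V ip. (norm (B g))\<^sup>2)"

section \<open>The covariance operator and the spaces \<open>U\<^sub>0\<close> and \<open>L\<^sub>2\<^sup>0\<close>\<close>

definition nonneg_op :: "('u::real_inner \<Rightarrow>\<^sub>L 'u) \<Rightarrow> bool" where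
  "nonneg_op Q \<longleftrightarrow>
     (\<forall>x y. blinfun_apply Q x \<bullet> y = x \<bullet> blinfun_apply Q y) \<and> (\<forall>x. 0 \<le> blinfun_apply Q x \<bullet> x)"

definition sqrt_op :: "('u::real_inner \<Rightarrow>\<^sub>L 'u) \<Rightarrow> ('u \<Rightarrow>\<^sub>L 'u)" where
  "sqrt_op Q = (THE R. nonneg_op R \<and> R o\<^sub>L R = Q)"

text \<open>\<open>Q\<^sup>-\<^sup>1\<^sup>/\<^sup>2\<close> is the pseudo-inverse of \<open>Q\<^sup>1\<^sup>/\<^sup>2\<close>; \<open>Q\<close> is allowed to have a kernel.\<close>

definition inv_sqrt_op :: "('u::real_inner \<Rightarrow>\<^sub>L 'u) \<Rightarrow> 'u \<Rightarrow> 'u" where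
  "inv_sqrt_op Q u =
     (THE v. blinfun_apply (sqrt_op Q) v = u \<and>
             (\<forall>w. blinfun_apply (sqrt_op Q) w = 0 \<longrightarrow> v \<bullet> w = 0))"

definition U0 :: "('u::real_inner \<Rightarrow>\<^sub>L 'u) \<Rightarrow> 'u set" where
  "U0 Q = range (blinfun_apply (sqrt_op Q))"

definition inner_U0 :: "('u::real_inner \<Rightarrow>\<^sub>L 'u) \<Rightarrow> 'u \<Rightarrow> 'u \<Rightarrow> real" where
  "inner_U0 Q u v = inv_sqrt_op Q u \<bullet> inv_sqrt_op Q v"

definition L20 :: "('u::real_inner \<Rightarrow>\<^sub>L 'u) \<Rightarrow> ('u \<Rightarrow> 'h::real_normed_vector) set" where
  "L20 Q = hs_operators (U0 Q) (inner_U0 Q)"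

definition L20_norm :: "('u::real_inner \<Rightarrow>\<^sub>L 'u) \<Rightarrow> ('u \<Rightarrow> 'h::real_normed_vector) \<Rightarrow> real" where
  "L20_norm Q B = hs_norm (U0 Q) (inner_U0 Q) B"

definition L20_borel :: "('u::real_inner \<Rightarrow>\<^sub>L 'u) \<Rightarrow> ('u \<Rightarrow> 'h::real_normed_vector) measure" where
  "L20_borel Q =
     sigma (L20 Q) {V. openin (Metric_space.mtopology (L20 Q) (\<lambda>B C. L20_norm Q (\<lambda>u. B u - C u))) V}"

section \<open>Filtrations, predictable processes, Wiener processes\<close>

text \<open>Time is \<open>real\<close>; only the \<open>F t\<close> with \<open>t \<ge> 0\<close> are relevant.\<close>

definition normal_filtration :: "'w measure \<Rightarrow> (real \<Rightarrow> 'w measure) \<Rightarrow> bool" where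
  "normal_filtration M F \<longleftrightarrow>
     (\<forall>t\<ge>0. subalgebra M (F t)) \<and>
     (\<forall>s\<ge>0. \<forall>t\<ge>s. sets (F s) \<subseteq> sets (F t)) \<and>
     null_sets M \<subseteq> sets (F 0) \<and>
     (\<forall>t\<ge>0. sets (F t) = (\<Inter>s\<in>{t<..}. sets (F s)))"

definition predictable_algebra ::
    "'w measure \<Rightarrow> (real \<Rightarrow> 'w measure) \<Rightarrow> real \<Rightarrow> (real \<times> 'w) measure" where
  "predictable_algebra M F T =
     sigma ({0..T} \<times> space M)
       ({{s<..t} \<times> A |s t A. 0 \<le> s \<and> s < t \<and> t \<le> T \<and> A \<in> sets (F s)} \<union>
        {{0} \<times> A |A. A \<in> sets (F 0)})"

definition predictable_process ::
    "'w measure \<Rightarrow> (real \<Rightarrow> 'w measure) \<Rightarrow> real \<Rightarrow> 'e measure \<Rightarrow> (real \<Rightarrow> 'w \<Rightarrow> 'e) \<Rightarrow> bool" where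
  "predictable_process M F T N X \<longleftrightarrow> (\<lambda>(t, \<omega>). X t \<omega>) \<in> predictable_algebra M F T \<rightarrow>\<^sub>M N"

text \<open>The centred Gaussian law with variance \<open>v \<ge> 0\<close>, degenerate for \<open>v = 0\<close>.\<close>

definition centred_gaussian :: "real \<Rightarrow> real measure" where
  "centred_gaussian v =
     (if v = 0 then return borel 0 else density lborel (\<lambda>x. ennreal (normal_density 0 (sqrt v) x)))"

definition indep_of_past :: "'w measure \<Rightarrow> 'w measure \<Rightarrow> 'e measure \<Rightarrow> ('w \<Rightarrow> 'e) \<Rightarrow> bool" where
  "indep_of_past M G N X \<longleftrightarrow>
     prob_space.indep_set M (sets G) (sets (vimage_algebra (space M) X N))"

definition real_wiener :: "'w measure \<Rightarrow> (real \<Rightarrow> 'w measure) \<Rightarrow> real \<Rightarrow> (real \<Rightarrow> 'w \<Rightarrow> real) \<Rightarrow> bool" where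
  "real_wiener M F v b \<longleftrightarrow>
     (\<forall>t\<ge>0. b t \<in> borel_measurable (F t)) \<and>
     (AE \<omega> in M. b 0 \<omega> = 0) \<and>
     (AE \<omega> in M. continuous_on {0..} (\<lambda>t. b t \<omega>)) \<and>
     (\<forall>s\<ge>0. \<forall>t\<ge>s. distr M borel (\<lambda>\<omega>. b t \<omega> - b s \<omega>) = centred_gaussian (v * (t - s))) \<and>
     (\<forall>s\<ge>0. \<forall>t\<ge>s. indep_of_past M (F s) borel (\<lambda>\<omega>. b t \<omega> - b s \<omega>))"

text \<open>
  The process \<open>W(t) = \<Sum>\<^sub>k e\<^sub>k \<beta>\<^sub>k(t)\<close> need not take values in \<open>U\<close>; it is given by its
  coordinates \<open>\<beta>\<^sub>k\<close> with respect to the eigenbasis \<open>e\<^sub>k\<close>. The index set \<open>I\<close> is finite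
  iff \<open>U\<close> is finite-dimensional. The last conjunct says that the increments of the whole
  process \<open>W\<close>, not just of each coordinate, are independent of the past.
\<close>

definition cylindrical_wiener ::
    "'w measure \<Rightarrow> (real \<Rightarrow> 'w measure) \<Rightarrow> ('u::real_inner \<Rightarrow>\<^sub>L 'u) \<Rightarrow>
     nat set \<Rightarrow> (nat \<Rightarrow> 'u) \<Rightarrow> (nat \<Rightarrow> real) \<Rightarrow> (nat \<Rightarrow> real \<Rightarrow> 'w \<Rightarrow> real) \<Rightarrow> bool" where
  "cylindrical_wiener M F Q I e lam \<beta> \<longleftrightarrow>
     inj_on e I \<and> orthonormal_basis UNIV (\<bullet>) (e ` I) \<and>
     (\<forall>k\<in>I. blinfun_apply Q (e k) = lam k *\<^sub>R e k) \<and>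
     (\<forall>k\<in>I. real_wiener M F (lam k) (\<beta> k)) \<and>
     prob_space.indep_vars M (\<lambda>_. Pi\<^sub>M {0..} (\<lambda>_. borel)) (\<lambda>k \<omega>. \<lambda>t\<in>{0..}. \<beta> k t \<omega>) I \<and>
     (\<forall>s\<ge>0. \<forall>t\<ge>s. indep_of_past M (F s)
        (Pi\<^sub>M I (\<lambda>_. borel)) (\<lambda>\<omega>. \<lambda>k\<in>I. \<beta> k t \<omega> - \<beta> k s \<omega>))"

section \<open>The stochastic integral\<close>

definition N2 ::
    "'w measure \<Rightarrow> (real \<Rightarrow> 'w measure) \<Rightarrow> ('u::real_inner \<Rightarrow>\<^sub>L 'u) \<Rightarrow> real \<Rightarrow>
     (real \<Rightarrow> 'w \<Rightarrow> 'u \<Rightarrow> 'h::real_normed_vector) set" where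
  "N2 M F Q T =
     {\<Phi>. predictable_process M F T (L20_borel Q) \<Phi> \<and>
         (\<integral>\<^sup>+\<omega>. (\<integral>\<^sup>+\<tau>\<in>{0..T}. ennreal ((L20_norm Q (\<Phi> \<tau> \<omega>))\<^sup>2) \<partial>lborel) \<partial>M) < \<infinity>}"

text \<open>
  An elementary process on \<open>[0,t]\<close> takes on \<open>(p m, p (m+1)]\<close> the value \<open>\<Theta> m\<close>, an
  \<open>F (p m)\<close>-measurable random element of \<open>L\<^sub>2\<^sup>0\<close> with finitely many values. Each value is
  required to vanish on all but finitely many \<open>e\<^sub>k\<close>, so that it can be applied to the
  increments of \<open>W = \<Sum>\<^sub>k e\<^sub>k \<beta>\<^sub>k\<close> by a finite sum. Such operators are dense in
  \<open>L\<^sub>2\<^sup>0\<close>. The \<open>e\<^sub>k\<close> outside \<open>U\<^sub>0\<close> are those with \<open>\<lambda>\<^sub>k = 0\<close>, for which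
  \<open>\<beta>\<^sub>k = 0\<close> almost surely.
\<close>

definition elementary_data ::
    "'w measure \<Rightarrow> (real \<Rightarrow> 'w measure) \<Rightarrow> ('u::real_inner \<Rightarrow>\<^sub>L 'u) \<Rightarrow> nat set \<Rightarrow> (nat \<Rightarrow> 'u) \<Rightarrow>
     real \<Rightarrow> nat \<Rightarrow> (nat \<Rightarrow> real) \<Rightarrow> (nat \<Rightarrow> 'w \<Rightarrow> 'u \<Rightarrow> 'h::real_normed_vector) \<Rightarrow> bool" where
  "elementary_data M F Q I e t n p \<Theta> \<longleftrightarrow>
     p 0 = 0 \<and> p n = t \<and> (\<forall>m<n. p m < p (Suc m)) \<and>
     (\<forall>m<n. finite (\<Theta> m ` space M) \<and>
        (\<forall>\<omega>\<in>space M. \<Theta> m \<omega> \<in> L20 Q \<and> finite {k\<in>I. e k \<in> U0 Q \<and> \<Theta> m \<omega> (e k) \<noteq> 0}) \<and>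
        (\<forall>B. {\<omega>\<in>space M. \<Theta> m \<omega> = B} \<in> sets (F (p m))))"

definition elementary_process ::
    "('u::real_inner \<Rightarrow>\<^sub>L 'u) \<Rightarrow> nat \<Rightarrow> (nat \<Rightarrow> real) \<Rightarrow> (nat \<Rightarrow> 'w \<Rightarrow> 'u \<Rightarrow> 'h::real_normed_vector) \<Rightarrow>
     real \<Rightarrow> 'w \<Rightarrow> 'u \<Rightarrow> 'h" where
  "elementary_process Q n p \<Theta> \<tau> \<omega> =
     (\<lambda>u\<in>U0 Q. \<Sum>m<n. indicat_real {p m<..p (Suc m)} \<tau> *\<^sub>R \<Theta> m \<omega> u)"

definition elementary_integral ::
    "('u::real_inner \<Rightarrow>\<^sub>L 'u) \<Rightarrow> nat set \<Rightarrow> (nat \<Rightarrow> 'u) \<Rightarrow> (nat \<Rightarrow> real \<Rightarrow> 'w \<Rightarrow> real) \<Rightarrow>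
     nat \<Rightarrow> (nat \<Rightarrow> real) \<Rightarrow> (nat \<Rightarrow> 'w \<Rightarrow> 'u \<Rightarrow> 'h::real_normed_vector) \<Rightarrow> 'w \<Rightarrow> 'h" where
  "elementary_integral Q I e \<beta> n p \<Theta> \<omega> =
     (\<Sum>m<n. \<Sum>k\<in>{k\<in>I. e k \<in> U0 Q \<and> \<Theta> m \<omega> (e k) \<noteq> 0}.
        (\<beta> k (p (Suc m)) \<omega> - \<beta> k (p m) \<omega>) *\<^sub>R \<Theta> m \<omega> (e k))"

text \<open>The stochastic integral over \<open>[0,t]\<close> is the extension by continuity, for the norms of
  \<open>\<N>\<^sup>2(0,t;L\<^sub>2\<^sup>0)\<close> and \<open>L\<^sup>2(\<Omega>;H)\<close>, of the integral of elementary processes.\<close>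

definition has_stoch_integral ::
    "'w measure \<Rightarrow> (real \<Rightarrow> 'w measure) \<Rightarrow> ('u::real_inner \<Rightarrow>\<^sub>L 'u) \<Rightarrow> nat set \<Rightarrow> (nat \<Rightarrow> 'u) \<Rightarrow>
     (nat \<Rightarrow> real \<Rightarrow> 'w \<Rightarrow> real) \<Rightarrow> real \<Rightarrow>
     (real \<Rightarrow> 'w \<Rightarrow> 'u \<Rightarrow> 'h::{real_inner, banach, second_countable_topology}) \<Rightarrow> ('w \<Rightarrow> 'h) \<Rightarrow> bool" where
  "has_stoch_integral M F Q I e \<beta> t \<Phi> X \<longleftrightarrow>
     \<Phi> \<in> N2 M F Q t \<and> X \<in> borel_measurable M \<and>
     (\<exists>n p \<Theta>.
        (\<forall>j. elementary_data M F Q I e t (n j) (p j) (\<Theta> j)) \<and>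
        (\<lambda>j. \<integral>\<^sup>+\<omega>. (\<integral>\<^sup>+\<tau>\<in>{0..t}. ennreal ((L20_norm Q
              (\<lambda>u. elementary_process Q (n j) (p j) (\<Theta> j) \<tau> \<omega> u - \<Phi> \<tau> \<omega> u))\<^sup>2) \<partial>lborel) \<partial>M)
          \<longlonglongrightarrow> 0 \<and>
        (\<lambda>j. \<integral>\<^sup>+\<omega>. ennreal ((norm (elementary_integral Q I e \<beta> (n j) (p j) (\<Theta> j) \<omega> - X \<omega>))\<^sup>2) \<partial>M)
          \<longlonglongrightarrow> 0)"

text \<open>Determined up to almost sure equality only.\<close>

definition stoch_integral ::
    "'w measure \<Rightarrow> (real \<Rightarrow> 'w measure) \<Rightarrow> ('u::real_inner \<Rightarrow>\<^sub>L 'u) \<Rightarrow> nat set \<Rightarrow> (nat \<Rightarrow> 'u) \<Rightarrow>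
     (nat \<Rightarrow> real \<Rightarrow> 'w \<Rightarrow> real) \<Rightarrow> real \<Rightarrow>
     (real \<Rightarrow> 'w \<Rightarrow> 'u \<Rightarrow> 'h::{real_inner, banach, second_countable_topology}) \<Rightarrow> 'w \<Rightarrow> 'h" where
  "stoch_integral M F Q I e \<beta> t \<Phi> = (SOME X. has_stoch_integral M F Q I e \<beta> t \<Phi> X)"

definition stoch_convolution ::
    "'w measure \<Rightarrow> (real \<Rightarrow> 'w measure) \<Rightarrow> ('u::real_inner \<Rightarrow>\<^sub>L 'u) \<Rightarrow> nat set \<Rightarrow> (nat \<Rightarrow> 'u) \<Rightarrow>
     (nat \<Rightarrow> real \<Rightarrow> 'w \<Rightarrow> real) \<Rightarrow> (real \<Rightarrow> ('h \<Rightarrow>\<^sub>L 'h)) \<Rightarrow>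
     (real \<Rightarrow> 'w \<Rightarrow> 'u \<Rightarrow> 'h::{real_inner, banach, second_countable_topology}) \<Rightarrow> real \<Rightarrow> 'w \<Rightarrow> 'h" where
  "stoch_convolution M F Q I e \<beta> S \<Psi> t =
     stoch_integral M F Q I e \<beta> t (\<lambda>\<tau> \<omega>. compose (U0 Q) (blinfun_apply (S (t - \<tau>))) (\<Psi> \<tau> \<omega>))"

section \<open>Volterra equations\<close>

definition closed_densely_defined :: "'h::real_normed_vector set \<Rightarrow> ('h \<Rightarrow> 'h) \<Rightarrow> bool" where
  "closed_densely_defined DA A \<longleftrightarrow>
     subspace DA \<and> linear_on DA A \<and> closed {(x, A x) |x. x \<in> DA} \<and> closure DA = UNIV"

definition resolvent ::
    "'h::{real_inner, banach, second_countable_topology} set \<Rightarrow> ('h \<Rightarrow> 'h) \<Rightarrow> (real \<Rightarrow> real) \<Rightarrow>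
     (real \<Rightarrow> ('h \<Rightarrow>\<^sub>L 'h)) \<Rightarrow> bool" where
  "resolvent DA A a S \<longleftrightarrow>
     (\<forall>x. continuous_on {0..} (\<lambda>t. blinfun_apply (S t) x)) \<and> S 0 = id_blinfun \<and>
     (\<forall>t\<ge>0. \<forall>x\<in>DA. blinfun_apply (S t) x \<in> DA \<and>
        A (blinfun_apply (S t) x) = blinfun_apply (S t) (A x)) \<and>
     (\<forall>t\<ge>0. \<forall>x\<in>DA. blinfun_apply (S t) x =
        x + (LINT \<tau>:{0..t}|lebesgue. a (t - \<tau>) *\<^sub>R A (blinfun_apply (S \<tau>) x)))"

end

theory Submission
  imports Defs
begin

text \<open>
  The It\^o isometry for elementary processes and the uniform boundedness of the resolvent on
  \<open>[0,T]\<close> bound the second moment of the stochastic convolution uniformly in \<open>t\<close>, and Tonelli's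
  theorem turns this into square integrability of almost every trajectory. The existence of the
  stochastic integrals is not needed: wherever the integral fails to exist, \<open>stoch_integral\<close> is a
  choice from an empty predicate, hence one and the same function of \<open>\<omega>\<close> for all such times, and a
  process that is constant in time is square integrable on \<open>[0,T]\<close>.
\<close>

section \<open>Orthonormal expansions\<close>

text \<open>The Hilbert-Schmidt norm is a sum over a basis fixed by choice, whereas an elementary
  integral is a finite sum over the eigenvectors \<open>e k\<close>. To link the two, the chosen set
  must be a basis at all, and the sum of squares must be moved to the images of the eigenvectors
  under Q^(1/2). Both rest on an explicit diagonal form of Q^(1/2) and of its pseudo-inverse, which
  are themselves defined by unique description. The isometry is proved for elementary processes
  only. For their limits an inequality with the constant 4 is enough, and it can be obtained by
  comparing real functions of time and chance whose joint measurability is at hand, instead of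
  operator-valued processes. The set of times at which the stochastic integral exists is not known
  to be measurable, so Tonelli's theorem cannot be used on it. The time interval is split by a
  measurable function instead, which vanishes exactly where the process agrees almost surely with
  one fixed random variable.\<close>

lemma has_sum_sum:
  fixes f :: "'i \<Rightarrow> 'a \<Rightarrow> 'b::topological_comm_monoid_add"
  assumes "finite K" "\<And>i. i \<in> K \<Longrightarrow> (f i has_sum s i) A"
  shows "((\<lambda>x. \<Sum>i\<in>K. f i x) has_sum (\<Sum>i\<in>K. s i)) A"
  using assms by (induction K rule: finite_induct) (auto intro: has_sum_add)

lemma norm_sum_orthonormal:
  fixes E :: "'a::real_inner set"
  assumes on: "\<forall>g\<in>E. \<forall>h\<in>E. g \<bullet> h = (if g = h then 1 else 0)"
    and "finite J" "J \<subseteq> E"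
  shows "(norm (\<Sum>g\<in>J. c g *\<^sub>R g))\<^sup>2 = (\<Sum>g\<in>J. (c g)\<^sup>2)"
proof -
  have "(norm (\<Sum>g\<in>J. c g *\<^sub>R g))\<^sup>2 = (\<Sum>g\<in>J. \<Sum>h\<in>J. c g * (c h * (g \<bullet> h)))"
    by (simp add: power2_norm_eq_inner inner_sum_left inner_sum_right sum_distrib_left)
       (subst sum.swap, simp add: inner_commute mult.left_commute)
  also have "\<dots> = (\<Sum>g\<in>J. \<Sum>h\<in>J. if h = g then (c g)\<^sup>2 else 0)"
  proof (intro sum.cong refl)
    fix g h assume "g \<in> J" "h \<in> J"
    then have "g \<bullet> h = (if g = h then 1 else 0)"
      using on assms(3) by blast
    then show "c g * (c h * (g \<bullet> h)) = (if h = g then (c g)\<^sup>2 else 0)"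
      by (simp add: power2_eq_square)
  qed
  finally show ?thesis
    using assms(2) by simp
qed

text \<open>Bessel's inequality: the difference of \<open>x\<close> and its projection onto the span
  of finitely many elements has a nonnegative square, which bounds every partial sum by the square
  of \<open>norm x\<close>.\<close>

lemma bessel_summable:
  fixes E :: "'a::real_inner set"
  assumes on: "\<forall>g\<in>E. \<forall>h\<in>E. g \<bullet> h = (if g = h then 1 else 0)"
  shows "(\<lambda>g. (x \<bullet> g)\<^sup>2) summable_on E"
proof (rule nonneg_bounded_partial_sums_imp_summable_on)
  show "\<forall>\<^sub>F J in finite_subsets_at_top E. (\<Sum>g\<in>J. (x \<bullet> g)\<^sup>2) \<le> (norm x)\<^sup>2"
  proof (rule eventually_finite_subsets_at_top_weakI)
    fix J assume J: "finite J" "J \<subseteq> E"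
    define y where "y = (\<Sum>g\<in>J. (x \<bullet> g) *\<^sub>R g)"
    have "x \<bullet> y = (\<Sum>g\<in>J. (x \<bullet> g)\<^sup>2)"
      by (simp add: y_def inner_sum_right power2_eq_square)
    moreover have "y \<bullet> y = (\<Sum>g\<in>J. (x \<bullet> g)\<^sup>2)"
      using norm_sum_orthonormal[OF on J] by (simp add: y_def power2_norm_eq_inner)
    moreover have "0 \<le> (x - y) \<bullet> (x - y)"
      by simp
    ultimately show "(\<Sum>g\<in>J. (x \<bullet> g)\<^sup>2) \<le> (norm x)\<^sup>2"
      by (simp add: inner_diff_left inner_diff_right inner_commute power2_norm_eq_inner)
  qed
qed simp

text \<open>Completeness gives the limit: by Pythagoras, a small tail of the squares makes the
  partial sums a Cauchy filter.\<close>

lemma riesz_fischer: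
  fixes E :: "'a::{real_inner, banach} set"
  assumes on: "\<forall>g\<in>E. \<forall>h\<in>E. g \<bullet> h = (if g = h then 1 else 0)"
    and c: "(\<lambda>g. (c g)\<^sup>2) summable_on E"
  shows "(\<lambda>g. c g *\<^sub>R g) summable_on E"
proof -
  let ?S = "sum (\<lambda>g. c g *\<^sub>R g)"
  have "cauchy_filter (filtermap ?S (finite_subsets_at_top E))"
    unfolding cauchy_filter_metric_filtermap
  proof (intro allI impI)
    fix r :: real assume r: "r > 0"
    define s where "s = (\<Sum>\<^sub>\<infinity>g\<in>E. (c g)\<^sup>2)"
    have "((\<lambda>g. (c g)\<^sup>2) has_sum s) E"
      using c by (simp add: s_def)
    then obtain D where D: "finite D" "D \<subseteq> E"
      "\<And>J. D \<subseteq> J \<Longrightarrow> finite J \<Longrightarrow> J \<subseteq> E \<Longrightarrow> dist (\<Sum>g\<in>J. (c g)\<^sup>2) s < (r/3)\<^sup>2"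
      using r by (auto simp: has_sum_def tendsto_iff eventually_finite_subsets_at_top
          elim!: allE[where x="(r/3)\<^sup>2"])
    \<comment> \<open>All finite index sets beyond \<open>D\<close>. Their partial sums lie within
      \<open>r/3\<close> of the one over \<open>D\<close>, so two of them differ by at most
      \<open>2 * r/3 < r\<close>.\<close>
    define P where "P J \<longleftrightarrow> finite J \<and> D \<subseteq> J \<and> J \<subseteq> E" for J
    have near: "dist (?S J) (?S D) \<le> r/3" if "P J" for J
    proof -
      have J: "finite J" "D \<subseteq> J" "J \<subseteq> E" using that by (auto simp: P_def)
      have "?S J - ?S D = ?S (J - D)"
        using J D by (simp add: sum_diff)
      then have "(dist (?S J) (?S D))\<^sup>2 = (\<Sum>g\<in>J - D. (c g)\<^sup>2)"
        using norm_sum_orthonormal[OF on, of "J - D" c] J by (auto simp: dist_norm)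
      also have "\<dots> = (\<Sum>g\<in>J. (c g)\<^sup>2) - (\<Sum>g\<in>D. (c g)\<^sup>2)"
        using J D by (simp add: sum_diff)
      \<comment> \<open>The terms are nonnegative, so the sum over \<open>J - D\<close> is at most
        the total \<open>s\<close> minus the sum over \<open>D\<close>.\<close>
      also have "\<dots> \<le> (r/3)\<^sup>2"
      proof -
        have "(\<Sum>g\<in>J. (c g)\<^sup>2) \<le> s"
          unfolding s_def using J c by (intro finite_sum_le_infsum) auto
        moreover have "dist (\<Sum>g\<in>D. (c g)\<^sup>2) s < (r/3)\<^sup>2"
          using D by auto
        ultimately show ?thesis by (simp add: dist_real_def abs_if split: if_splits)
      qed
      finally show ?thesis
        using r by (metis power2_le_imp_le less_eq_real_def divide_pos_pos zero_less_numeral)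
    qed
    have "P D" "eventually P (finite_subsets_at_top E)"
      using D by (auto simp: P_def eventually_finite_subsets_at_top intro!: exI[of _ D])
    moreover have "dist (?S J) (?S K) < r" if "P J" "P K" for J K
      using near[OF that(1)] near[OF that(2)] dist_triangle2[of "?S J" "?S K" "?S D"] r by linarith
    ultimately show "\<exists>P. eventually P (finite_subsets_at_top E) \<and>
        (\<forall>J K. P J \<and> P K \<longrightarrow> dist (?S J) (?S K) < r)"
      by (intro exI[of _ P] conjI allI impI) auto
  qed
  moreover have "filtermap ?S (finite_subsets_at_top E) \<noteq> bot"
    by (simp add: filtermap_bot_iff)
  ultimately obtain y where "filtermap ?S (finite_subsets_at_top E) \<le> nhds y"
    using cauchy_filter_complete_converges[OF _ complete_UNIV, of "filtermap ?S (finite_subsets_at_top E)"] by auto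
  then show ?thesis
    by (auto simp: summable_on_def has_sum_def filterlim_def)
qed

lemma orthonormal_coefficient:
  fixes E :: "'a::{real_inner, banach} set"
  assumes on: "\<forall>g\<in>E. \<forall>h\<in>E. g \<bullet> h = (if g = h then 1 else 0)"
    and y: "((\<lambda>g. c g *\<^sub>R g) has_sum y) E" and "g \<in> E"
  shows "y \<bullet> g = c g"
proof -
  have "((\<lambda>h. (c h *\<^sub>R h) \<bullet> g) has_sum (y \<bullet> g)) E"
    using y by (rule has_sum_bounded_linear[OF bounded_linear_inner_left])
  moreover have "((\<lambda>h. (c h *\<^sub>R h) \<bullet> g) has_sum c g) E"
    using assms by (intro has_sum_finite_neutralI[of "{g}"]) auto
  ultimately show ?thesis by (rule has_sum_unique)
qed

section \<open>Orthonormal bases of a subspace with an inner product of its own\<close>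

lemma orthonormal_basisD:
  assumes "orthonormal_basis V ip G"
  shows orthonormal_basis_subset: "G \<subseteq> V"
    and orthonormal_basis_ip: "g \<in> G \<Longrightarrow> h \<in> G \<Longrightarrow> ip g h = (if g = h then 1 else 0)"
    and orthonormal_basis_max: "v \<in> V \<Longrightarrow> (\<And>g. g \<in> G \<Longrightarrow> ip v g = 0) \<Longrightarrow> v = 0"
proof -
  note G = assms[unfolded orthonormal_basis_def]
  show "G \<subseteq> V" using G by (rule conjunct1)
  show "ip g h = (if g = h then 1 else 0)" if "g \<in> G" "h \<in> G"
    using G[THEN conjunct2, THEN conjunct1] that by blast
  show "v = 0" if "v \<in> V" "\<And>g. g \<in> G \<Longrightarrow> ip v g = 0"
    using G[THEN conjunct2, THEN conjunct2] that by blast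
qed

text \<open>The inner product of \<open>V\<close> is pulled back along \<open>J\<close>, and
  closedness of the image expresses completeness of \<open>V\<close>. The ambient type of
  \<open>V\<close> is only a vector space, so all convergence takes place in the target of
  \<open>J\<close>. The intended \<open>J\<close> is the pseudo-inverse of Q^(1/2).\<close>

locale embedded_hilbert =
  fixes V :: "'a::real_vector set" and J :: "'a \<Rightarrow> 'b::{real_inner, banach}"
  assumes sub: "subspace V" and lin: "linear_on V J"
    and inj: "\<And>v. v \<in> V \<Longrightarrow> J v = 0 \<Longrightarrow> v = 0" and closed: "closed (J ` V)"
begin

definition ip where "ip u v = J u \<bullet> J v"

lemma J_diff: "u \<in> V \<Longrightarrow> v \<in> V \<Longrightarrow> J (u - v) = J u - J v"
proof -
  assume *: "u \<in> V" "v \<in> V"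
  then have "J (u + (-1) *\<^sub>R v) = J u + (-1) *\<^sub>R J v"
    using lin subspace_scale[OF sub, of v "-1"] unfolding linear_on_def by metis
  then show ?thesis by simp
qed

lemma linear_on_sum:
  fixes B :: "'a \<Rightarrow> 'c::real_vector"
  assumes B: "linear_on V B" and "finite K" "K \<subseteq> V"
  shows "(\<Sum>g\<in>K. c g *\<^sub>R g) \<in> V \<and> B (\<Sum>g\<in>K. c g *\<^sub>R g) = (\<Sum>g\<in>K. c g *\<^sub>R B g)"
  using assms(2,3)
proof (induction K rule: finite_induct)
  case empty
  have "B (0 *\<^sub>R 0) = 0 *\<^sub>R B 0"
    using B subspace_0[OF sub] unfolding linear_on_def by blast
  then show ?case using subspace_0[OF sub] by simp
next
  case (insert x K)
  then show ?case
    using B subspace_scale[OF sub, of x "c x"] subspace_add[OF sub]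
    by (simp add: linear_on_def)
qed

text \<open>Bessel and Riesz-Fischer give a limit \<open>y\<close> of the series, and closedness of
  the image makes it \<open>J w\<close> with \<open>w\<close> in \<open>V\<close>. Then
  \<open>v - w\<close> is orthogonal to \<open>G\<close>, so it is 0 by maximality.\<close>

lemma expansion:
  assumes G: "orthonormal_basis V ip G" and v: "v \<in> V"
  shows "((\<lambda>g. ip v g *\<^sub>R J g) has_sum J v) G"
proof -
  note GV = orthonormal_basis_subset[OF G]
    and on = orthonormal_basis_ip[OF G, unfolded ip_def]
    and max = orthonormal_basis_max[OF G, unfolded ip_def]
  have inj: "inj_on J G"
  proof (rule inj_onI)
    fix g h assume "g \<in> G" "h \<in> G" "J g = J h"
    then have "(if g = h then 1 else 0) = (1::real)"
      using on[of g h] on[of h h] by simp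
    then show "g = h" by (simp split: if_splits)
  qed
  have on': "\<forall>g\<in>J ` G. \<forall>h\<in>J ` G. g \<bullet> h = (if g = h then 1 else 0)"
  proof (intro ballI)
    fix a b assume "a \<in> J ` G" "b \<in> J ` G"
    then obtain g h where "g \<in> G" "h \<in> G" "a = J g" "b = J h" by blast
    then show "a \<bullet> b = (if a = b then 1 else 0)"
      using on[OF \<open>g \<in> G\<close> \<open>h \<in> G\<close>] inj_on_eq_iff[OF inj \<open>g \<in> G\<close> \<open>h \<in> G\<close>] by simp
  qed
  obtain y where y: "((\<lambda>g. (J v \<bullet> g) *\<^sub>R g) has_sum y) (J ` G)"
    using riesz_fischer[OF on' bessel_summable[OF on', of "J v"]] unfolding summable_on_def by blast
  then have y': "((\<lambda>g. ip v g *\<^sub>R J g) has_sum y) G"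
    unfolding has_sum_reindex[OF inj] by (simp only: o_def ip_def)
  have "y \<in> J ` V"
  proof (rule Lim_in_closed_set[OF closed])
    show "((\<lambda>K. \<Sum>g\<in>K. ip v g *\<^sub>R J g) \<longlongrightarrow> y) (finite_subsets_at_top G)"
      using y' by (simp add: has_sum_def)
    show "\<forall>\<^sub>F K in finite_subsets_at_top G. (\<Sum>g\<in>K. ip v g *\<^sub>R J g) \<in> J ` V"
    proof (rule eventually_finite_subsets_at_top_weakI)
      fix K assume "finite K" "K \<subseteq> G"
      then have "(\<Sum>g\<in>K. ip v g *\<^sub>R g) \<in> V \<and>
          J (\<Sum>g\<in>K. ip v g *\<^sub>R g) = (\<Sum>g\<in>K. ip v g *\<^sub>R J g)"
        using GV by (intro linear_on_sum[OF lin]) auto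
      then show "(\<Sum>g\<in>K. ip v g *\<^sub>R J g) \<in> J ` V"
        using imageI[of "\<Sum>g\<in>K. ip v g *\<^sub>R g" V J] by simp
    qed
  qed simp
  then obtain w where w: "w \<in> V" "y = J w" by auto
  have "v - w = 0"
  proof (rule max)
    show "v - w \<in> V" using v w sub by (simp add: subspace_diff)
    fix g assume "g \<in> G"
    then have "J w \<bullet> J g = J v \<bullet> J g"
      using orthonormal_coefficient[OF on' y imageI] w(2) by blast
    then show "J (v - w) \<bullet> J g = 0"
      using v w by (simp add: J_diff inner_diff_left)
  qed
  then show ?thesis using y' w by simp
qed

lemma parseval:
  assumes G: "orthonormal_basis V ip G" and v: "v \<in> V"
  shows "((\<lambda>g. ip v g * ip g w) has_sum ip v w) G"
  using has_sum_bounded_linear[OF bounded_linear_inner_left expansion[OF G v], of "J w"]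
  by (simp add: ip_def)

text \<open>The error of a partial sum under \<open>B\<close> is at most \<open>C\<close> times its
  error under \<open>J\<close>, and the latter tends to 0 by \<open>expansion\<close>.\<close>

lemma operator_expansion:
  fixes B :: "'a \<Rightarrow> 'c::real_normed_vector"
  assumes G: "orthonormal_basis V ip G" and B: "linear_on V B"
    and bd: "\<And>v. v \<in> V \<Longrightarrow> norm (B v) \<le> C * norm (J v)" and v: "v \<in> V"
  shows "((\<lambda>g. ip v g *\<^sub>R B g) has_sum B v) G"
proof -
  note GV = orthonormal_basis_subset[OF G]
  have B_diff: "B (u - v) = B u - B v" if "u \<in> V" "v \<in> V" for u v
  proof -
    have "B (u + (-1) *\<^sub>R v) = B u + (-1) *\<^sub>R B v"
      using that B subspace_scale[OF sub, of v "-1"] unfolding linear_on_def by metis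
    then show ?thesis by simp
  qed
  have "((\<lambda>K. C * norm ((\<Sum>g\<in>K. ip v g *\<^sub>R J g) - J v)) \<longlongrightarrow> C * norm (J v - J v)) (finite_subsets_at_top G)"
    using expansion[OF G v] unfolding has_sum_def
    by (intro tendsto_mult_left tendsto_norm tendsto_diff tendsto_const)
  then have "((\<lambda>K. C * norm ((\<Sum>g\<in>K. ip v g *\<^sub>R J g) - J v)) \<longlongrightarrow> 0) (finite_subsets_at_top G)"
    by simp
  moreover have "\<forall>\<^sub>F K in finite_subsets_at_top G.
      norm ((\<Sum>g\<in>K. ip v g *\<^sub>R B g) - B v) \<le> C * norm ((\<Sum>g\<in>K. ip v g *\<^sub>R J g) - J v)"
  proof (rule eventually_finite_subsets_at_top_weakI)
    fix K assume K: "finite K" "K \<subseteq> G"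
    let ?x = "\<Sum>g\<in>K. ip v g *\<^sub>R g"
    have KV: "K \<subseteq> V" using K(2) GV by (rule order_trans)
    have x: "?x \<in> V"
      using linear_on_sum[OF B K(1) KV] by (rule conjunct1)
    have "B ?x = (\<Sum>g\<in>K. ip v g *\<^sub>R B g)" "J ?x = (\<Sum>g\<in>K. ip v g *\<^sub>R J g)"
      by (rule linear_on_sum[OF B K(1) KV, THEN conjunct2] linear_on_sum[OF lin K(1) KV, THEN conjunct2])+
    then show "norm ((\<Sum>g\<in>K. ip v g *\<^sub>R B g) - B v) \<le> C * norm ((\<Sum>g\<in>K. ip v g *\<^sub>R J g) - J v)"
      using bd[OF subspace_diff[OF sub x v]] unfolding B_diff[OF x v] J_diff[OF x v] by (simp only:)
  qed
  ultimately have "((\<lambda>K. (\<Sum>g\<in>K. ip v g *\<^sub>R B g) - B v) \<longlongrightarrow> 0) (finite_subsets_at_top G)"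
    by (rule Lim_null_comparison[rotated])
  then show ?thesis
    by (simp add: has_sum_def LIM_zero_iff)
qed

text \<open>Independence of the Hilbert-Schmidt sum from the basis, for \<open>B\<close> with finite
  support \<open>K\<close> in one of the two bases. Each \<open>B g\<close> is then a finite sum,
  its square a finite double sum, and only the sum over \<open>g\<close> is infinite.\<close>

lemma sum_norm_squares_basis_change:
  fixes B :: "'a \<Rightarrow> 'c::real_inner"
  assumes F: "orthonormal_basis V ip F" and G: "orthonormal_basis V ip G"
    and B: "linear_on V B" and bd: "\<And>v. v \<in> V \<Longrightarrow> norm (B v) \<le> C * norm (J v)"
    and K: "finite K" "K \<subseteq> F" "\<And>f. f \<in> F - K \<Longrightarrow> B f = 0"
  shows "((\<lambda>g. (norm (B g))\<^sup>2) has_sum (\<Sum>f\<in>K. (norm (B f))\<^sup>2)) G"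
proof -
  note FV = orthonormal_basis_subset[OF F] and GV = orthonormal_basis_subset[OF G]
  have Bg: "B g = (\<Sum>f\<in>K. ip g f *\<^sub>R B f)" if "g \<in> G" for g
  proof -
    have "((\<lambda>f. ip g f *\<^sub>R B f) has_sum B g) F"
      using that GV by (intro operator_expansion[OF F B]) (blast intro: bd)+
    moreover have "((\<lambda>f. ip g f *\<^sub>R B f) has_sum (\<Sum>f\<in>K. ip g f *\<^sub>R B f)) F"
      using K by (intro has_sum_finite_neutralI) auto
    ultimately show ?thesis by (rule has_sum_unique)
  qed
  \<comment> \<open>Parseval in \<open>G\<close>, applied to each pair \<open>f\<close>,
    \<open>h\<close>, replaces the sum over \<open>g\<close> by \<open>ip f h\<close>, which is a
    Kronecker delta on \<open>K\<close>.\<close>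
  have "((\<lambda>g. \<Sum>f\<in>K. \<Sum>h\<in>K. (ip f g * ip g h) * (B f \<bullet> B h)) has_sum
      (\<Sum>f\<in>K. \<Sum>h\<in>K. ip f h * (B f \<bullet> B h))) G"
    using K FV by (intro has_sum_sum has_sum_cmult_left parseval[OF G]) auto
  moreover have "(\<Sum>f\<in>K. \<Sum>h\<in>K. (ip f g * ip g h) * (B f \<bullet> B h)) = (norm (B g))\<^sup>2" if "g \<in> G" for g
  proof -
    have "(norm (B g))\<^sup>2 = (\<Sum>f\<in>K. \<Sum>h\<in>K. ip g f * (ip g h * (B f \<bullet> B h)))"
      unfolding Bg[OF that] power2_norm_eq_inner inner_sum_left inner_sum_right inner_scaleR_left
        inner_scaleR_right sum_distrib_left
      by (intro sum.cong refl) (simp only: inner_commute)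
    then show ?thesis
      by (simp add: ip_def inner_commute mult.assoc)
  qed
  moreover have "(\<Sum>f\<in>K. \<Sum>h\<in>K. ip f h * (B f \<bullet> B h)) = (\<Sum>f\<in>K. \<Sum>h\<in>K. if h = f then (norm (B f))\<^sup>2 else 0)"
  proof (intro sum.cong refl)
    fix f h assume "f \<in> K" "h \<in> K"
    then have "ip f h = (if f = h then 1 else 0)"
      using K(2) by (intro orthonormal_basis_ip[OF F]) auto
    then show "ip f h * (B f \<bullet> B h) = (if h = f then (norm (B f))\<^sup>2 else 0)"
      by (simp add: power2_norm_eq_inner)
  qed
  moreover have "(\<Sum>f\<in>K. \<Sum>h\<in>K. if h = f then (norm (B f))\<^sup>2 else 0) = (\<Sum>f\<in>K. (norm (B f))\<^sup>2)"
    using K(1) by simp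
  ultimately show ?thesis
    using has_sum_cong[of G "\<lambda>g. \<Sum>f\<in>K. \<Sum>h\<in>K. (ip f g * ip g h) * (B f \<bullet> B h)" "\<lambda>g. (norm (B g))\<^sup>2"]
    by simp
qed

end

section \<open>The space of Hilbert--Schmidt operators on the image of the square root\<close>

lemma nonneg_op_D:
  assumes "nonneg_op R"
  shows "blinfun_apply R x \<bullet> y = x \<bullet> blinfun_apply R y" "0 \<le> blinfun_apply R x \<bullet> x"
  using assms unfolding nonneg_op_def by blast+

text \<open>Basis vectors have norm 1, so the eigenvalue of \<open>g\<close> is
  \<open>Q g \<bullet> g\<close>; the basis can thus be a plain set, without an eigenvalue
  function.\<close>

locale diagonal_op =
  fixes Q :: "'u::{real_inner, banach} \<Rightarrow>\<^sub>L 'u" and E :: "'u set"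
  assumes nonneg: "nonneg_op Q" and onb: "orthonormal_basis UNIV (\<bullet>) E"
    and eig: "\<And>g. g \<in> E \<Longrightarrow> blinfun_apply Q g = (blinfun_apply Q g \<bullet> g) *\<^sub>R g"
begin

definition s where "s g = sqrt (blinfun_apply Q g \<bullet> g)"

lemma s_nonneg: "0 \<le> s g" and s_sq: "s g * s g = blinfun_apply Q g \<bullet> g"
  using nonneg_op_D(2)[OF nonneg] by (simp_all add: s_def)

lemma on: "\<forall>g\<in>E. \<forall>h\<in>E. g \<bullet> h = (if g = h then 1 else 0)"
  using orthonormal_basis_ip[OF onb] by blast

lemma eqI: "(\<And>g. g \<in> E \<Longrightarrow> x \<bullet> g = y \<bullet> g) \<Longrightarrow> x = y"
  using orthonormal_basis_max[OF onb, of "x - y"] by (simp add: inner_diff_left)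

lemma s_sq_le: "g \<in> E \<Longrightarrow> (s g)\<^sup>2 \<le> norm Q"
proof -
  assume g: "g \<in> E"
  then have "norm g = 1" using on by (simp add: norm_eq_sqrt_inner)
  then have "blinfun_apply Q g \<bullet> g \<le> norm Q"
    using norm_cauchy_schwarz[of "blinfun_apply Q g" g] norm_blinfun[of Q g] by simp
  then show ?thesis by (simp add: power2_eq_square s_sq)
qed

lemma has_sum_inner: "((\<lambda>g. (x \<bullet> g) * (y \<bullet> g)) has_sum x \<bullet> y) E"
proof -
  interpret id: embedded_hilbert "UNIV :: 'u set" "\<lambda>x. x"
    by unfold_locales (auto simp: linear_on_def)
  have "id.ip = (\<bullet>)" by (simp add: id.ip_def fun_eq_iff)
  then show ?thesis using id.parseval[of E x y] onb by (simp add: inner_commute)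
qed

text \<open>The root acts diagonally with the eigenvalues \<open>s g\<close>. These are bounded by
  \<open>sqrt (norm Q)\<close>, so the series converges by Riesz-Fischer, and all identities are
  checked on coordinates.\<close>

lemma sqrt_exists: "\<exists>R. nonneg_op R \<and> R o\<^sub>L R = Q"
proof -
  have sq: "(s g * (x \<bullet> g))\<^sup>2 \<le> norm Q * (x \<bullet> g)\<^sup>2" if "g \<in> E" for x g
    using mult_right_mono[OF s_sq_le[OF that], of "(x \<bullet> g)\<^sup>2"] by (simp add: power_mult_distrib)
  have "\<exists>y. ((\<lambda>g. (s g * (x \<bullet> g)) *\<^sub>R g) has_sum y) E" for x
  proof -
    have "(\<lambda>g. norm Q * (x \<bullet> g)\<^sup>2) summable_on E"
      by (intro summable_on_cmult_right bessel_summable[OF on])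
    then have "(\<lambda>g. (s g * (x \<bullet> g))\<^sup>2) summable_on E"
      by (rule summable_on_comparison_test) (use sq in auto)
    from riesz_fischer[OF on this] show ?thesis
      by (simp add: summable_on_def)
  qed
  then obtain R where R: "\<And>x. ((\<lambda>g. (s g * (x \<bullet> g)) *\<^sub>R g) has_sum R x) E"
    by metis
  have coeff: "R x \<bullet> g = s g * (x \<bullet> g)" if "g \<in> E" for x g
    using orthonormal_coefficient[OF on R that] .
  have "bounded_linear R"
  proof (rule bounded_linear_intro)
    show "R (x + y) = R x + R y" for x y
      by (rule eqI) (simp add: coeff inner_add_left algebra_simps)
    show "R (r *\<^sub>R x) = r *\<^sub>R R x" for r x
      by (rule eqI) (simp add: coeff)
    show "norm (R x) \<le> norm x * sqrt (norm Q)" for x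
    proof -
      have "(norm (R x))\<^sup>2 \<le> norm Q * (norm x)\<^sup>2"
      proof (rule has_sum_mono)
        show "((\<lambda>g. (s g * (x \<bullet> g))\<^sup>2) has_sum (norm (R x))\<^sup>2) E"
          using has_sum_inner[of "R x" "R x"]
            has_sum_cong[of E "\<lambda>g. (R x \<bullet> g) * (R x \<bullet> g)" "\<lambda>g. (s g * (x \<bullet> g))\<^sup>2"]
          by (simp add: coeff power2_eq_square[of "s _ * _"] power2_norm_eq_inner)
        show "((\<lambda>g. norm Q * (x \<bullet> g)\<^sup>2) has_sum norm Q * (norm x)\<^sup>2) E"
          using has_sum_cmult_right[OF has_sum_inner[of x x], of "norm Q"]
          by (simp add: power2_eq_square[of "x \<bullet> _"] power2_norm_eq_inner)
      qed (use sq in auto)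
      then have "sqrt ((norm (R x))\<^sup>2) \<le> sqrt (norm Q * (norm x)\<^sup>2)"
        by (rule real_sqrt_le_mono)
      then show ?thesis by (simp add: real_sqrt_mult mult.commute)
    qed
  qed
  then have BR: "blinfun_apply (Blinfun R) = R"
    by (rule bounded_linear_Blinfun_apply)
  \<comment> \<open>The series is symmetric in \<open>x\<close> and \<open>y\<close> and has
    nonnegative terms for \<open>x = y\<close>, which yields both halves of
    \<open>nonneg_op\<close>.\<close>
  have sym: "((\<lambda>g. s g * (x \<bullet> g) * (y \<bullet> g)) has_sum R x \<bullet> y) E" for x y
    using has_sum_inner[of "R x" y] has_sum_cong[of E "\<lambda>g. (R x \<bullet> g) * (y \<bullet> g)"] coeff by simp
  have "nonneg_op (Blinfun R)"
    unfolding nonneg_op_def BR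
  proof (intro conjI allI)
    show "R x \<bullet> y = x \<bullet> R y" for x y
      using sym[of x y] sym[of y x] by (subst inner_commute[of x]) (simp add: ac_simps has_sum_unique)
    show "0 \<le> R x \<bullet> x" for x
      by (rule has_sum_nonneg[OF sym]) (simp add: s_nonneg mult.assoc)
  qed
  moreover have "R (R x) = blinfun_apply Q x" for x
  proof (rule eqI)
    fix g assume g: "g \<in> E"
    then have "blinfun_apply Q x \<bullet> g = x \<bullet> ((blinfun_apply Q g \<bullet> g) *\<^sub>R g)"
      using nonneg_op_D(1)[OF nonneg, of x g] eig[OF g] by simp
    then show "R (R x) \<bullet> g = blinfun_apply Q x \<bullet> g"
      using g by (simp add: coeff s_sq flip: mult.assoc)
  qed
  then have "Blinfun R o\<^sub>L Blinfun R = Q"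
    by (intro blinfun_eqI) (simp add: BR)
  ultimately show ?thesis by blast
qed

text \<open>With \<open>w = R g - s g *\<^sub>R g\<close> one has \<open>R w + s g *\<^sub>R w = 0\<close>, and \<open>R + s g\<close> is injective
  if \<open>s g > 0\<close>.\<close>

lemma sqrt_eigenvector:
  assumes R: "nonneg_op R" "R o\<^sub>L R = Q" and g: "g \<in> E"
  shows "blinfun_apply R g = s g *\<^sub>R g"
proof -
  have RR: "blinfun_apply R (blinfun_apply R x) = blinfun_apply Q x" for x
    using R(2) by auto
  show ?thesis
  proof (cases "s g = 0")
    case True
    have "(norm (blinfun_apply R g))\<^sup>2 = blinfun_apply Q g \<bullet> g"
      using nonneg_op_D(1)[OF R(1), of "blinfun_apply R g" g]
      by (simp add: power2_norm_eq_inner RR)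
    also have "\<dots> = 0" using s_sq[of g] True by simp
    finally show ?thesis using True by simp
  next
    case False
    define w where "w = blinfun_apply R g - s g *\<^sub>R g"
    have "blinfun_apply R w = blinfun_apply Q g - s g *\<^sub>R blinfun_apply R g"
      by (simp add: w_def blinfun.bilinear_simps RR)
    also have "blinfun_apply Q g = (s g * s g) *\<^sub>R g"
      using eig[OF g] by (simp add: s_sq)
    finally have "blinfun_apply R w = - s g *\<^sub>R w"
      by (simp add: w_def algebra_simps)
    then have "0 \<le> - s g * (w \<bullet> w)"
      using nonneg_op_D(2)[OF R(1), of w] by simp
    then have "w \<bullet> w \<le> 0"
      using False s_nonneg[of g] by (simp add: mult_le_0_iff)
    then have "w = 0"
      by (metis inner_eq_zero_iff inner_ge_zero order_antisym)
    then show ?thesis by (simp add: w_def)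
  qed
qed

lemma sqrt_coeff:
  assumes "nonneg_op R" "R o\<^sub>L R = Q" "g \<in> E"
  shows "blinfun_apply R x \<bullet> g = s g * (x \<bullet> g)"
  using nonneg_op_D(1)[OF assms(1), of x g] sqrt_eigenvector[OF assms] by simp

text \<open>Any nonnegative root has its coordinates prescribed by \<open>sqrt_coeff\<close>. Hence
  it is unique, and the description defining \<open>sqrt_op\<close> denotes it.\<close>

lemma sqrt_op: "nonneg_op (sqrt_op Q)" "sqrt_op Q o\<^sub>L sqrt_op Q = Q"
proof -
  have "\<exists>!R. nonneg_op R \<and> R o\<^sub>L R = Q"
  proof (rule ex_ex1I[OF sqrt_exists])
    fix R R' assume *: "nonneg_op R \<and> R o\<^sub>L R = Q" "nonneg_op R' \<and> R' o\<^sub>L R' = Q"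
    show "R = R'"
    proof (intro blinfun_eqI eqI)
      fix x g assume "g \<in> E"
      then show "blinfun_apply R x \<bullet> g = blinfun_apply R' x \<bullet> g"
        using * by (simp add: sqrt_coeff)
    qed
  qed
  from theI'[OF this] show "nonneg_op (sqrt_op Q)" "sqrt_op Q o\<^sub>L sqrt_op Q = Q"
    by (simp_all add: sqrt_op_def)
qed

abbreviation R where "R \<equiv> blinfun_apply (sqrt_op Q)"

lemma R_coeff: "g \<in> E \<Longrightarrow> R x \<bullet> g = s g * (x \<bullet> g)"
  by (rule sqrt_coeff[OF sqrt_op])

lemma R_eigenvector: "g \<in> E \<Longrightarrow> R g = s g *\<^sub>R g"
  by (rule sqrt_eigenvector[OF sqrt_op])

text \<open>The range of the pseudo-inverse, which selects the preimage orthogonal to the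
  kernel.\<close>

definition orth_ker where "orth_ker = {v. \<forall>w. R w = 0 \<longrightarrow> v \<bullet> w = 0}"

lemma orth_ker_closed: "closed orth_ker"
proof -
  have "orth_ker = (\<Inter>w\<in>{w. R w = 0}. {v. v \<bullet> w = 0})"
    by (auto simp: orth_ker_def)
  also have "closed \<dots>"
    by (intro closed_INT ballI closed_Collect_eq continuous_intros)
  finally show ?thesis .
qed

lemma orth_ker_subspace: "subspace orth_ker"
  by (auto simp: subspace_def orth_ker_def inner_add_left)

lemma orth_ker_inj: "v \<in> orth_ker \<Longrightarrow> R v = 0 \<Longrightarrow> v = 0"
  unfolding orth_ker_def using inner_eq_zero_iff by blast

lemma orth_ker_eigenvector: "g \<in> E \<Longrightarrow> s g > 0 \<Longrightarrow> g \<in> orth_ker"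
proof -
  assume g: "g \<in> E" "s g > 0"
  have "w \<bullet> g = 0" if "R w = 0" for w
    using R_coeff[OF g(1), of w] g that by simp
  then show ?thesis by (simp add: orth_ker_def inner_commute)
qed

text \<open>From a preimage \<open>x\<close>, the components along eigenvectors with
  \<open>s g = 0\<close> are dropped. The image under \<open>R\<close> stays the same, and what
  remains is a series of eigenvectors orthogonal to the kernel.\<close>

lemma U0_preimage: "u \<in> U0 Q \<Longrightarrow> \<exists>v\<in>orth_ker. R v = u"
proof -
  assume "u \<in> U0 Q"
  then obtain x where x: "u = R x" by (auto simp: U0_def)
  define E' where "E' = {g\<in>E. s g > 0}"
  have on': "\<forall>g\<in>E'. \<forall>h\<in>E'. g \<bullet> h = (if g = h then 1 else 0)"
    using on by (simp add: E'_def)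
  obtain v where v: "((\<lambda>g. (x \<bullet> g) *\<^sub>R g) has_sum v) E'"
    using riesz_fischer[OF on' bessel_summable[OF on', of x]] unfolding summable_on_def by blast
  have "R v = R x"
  proof (rule eqI)
    fix g assume g: "g \<in> E"
    show "R v \<bullet> g = R x \<bullet> g"
    proof (cases "s g > 0")
      case True
      then have "v \<bullet> g = x \<bullet> g"
        using g by (intro orthonormal_coefficient[OF on' v]) (simp add: E'_def)
      then show ?thesis using g by (simp add: R_coeff)
    next
      case False
      then show ?thesis using g s_nonneg[of g] by (simp add: R_coeff)
    qed
  qed
  moreover have "v \<bullet> w = 0" if "R w = 0" for w
  proof -
    have "((\<lambda>g. ((x \<bullet> g) *\<^sub>R g) \<bullet> w) has_sum v \<bullet> w) E'"
      by (rule has_sum_bounded_linear[OF bounded_linear_inner_left v])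
    moreover have "g \<bullet> w = 0" if "g \<in> E'" for g
      using orth_ker_eigenvector[of g] that \<open>R w = 0\<close> by (simp add: E'_def orth_ker_def)
    ultimately have "((\<lambda>g. 0::real) has_sum v \<bullet> w) E'"
      using has_sum_cong[of E' "\<lambda>g. ((x \<bullet> g) *\<^sub>R g) \<bullet> w" "\<lambda>g. 0"] by simp
    then show ?thesis using has_sum_unique[OF _ has_sum_0_simp] by blast
  qed
  ultimately show ?thesis using x by (auto simp: orth_ker_def)
qed

text \<open>Two preimages orthogonal to the kernel differ by an element that lies both in the kernel
  and in its complement.\<close>

lemma inv_sqrt_R: "v \<in> orth_ker \<Longrightarrow> inv_sqrt_op Q (R v) = v"
  unfolding inv_sqrt_op_def
proof (rule the_equality)
  assume v: "v \<in> orth_ker"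
  then show "R v = R v \<and> (\<forall>w. R w = 0 \<longrightarrow> v \<bullet> w = 0)" by (simp add: orth_ker_def)
  fix v' assume *: "R v' = R v \<and> (\<forall>w. R w = 0 \<longrightarrow> v' \<bullet> w = 0)"
  then have "v' - v \<in> orth_ker" "R (v' - v) = 0"
    using v subspace_diff[OF orth_ker_subspace, of v' v]
    by (auto simp: orth_ker_def blinfun.diff_right)
  from orth_ker_inj[OF this] show "v' = v" by simp
qed

lemma inv_sqrt: "u \<in> U0 Q \<Longrightarrow> inv_sqrt_op Q u \<in> orth_ker \<and> R (inv_sqrt_op Q u) = u"
  using U0_preimage[of u] inv_sqrt_R by auto

lemma U0_subspace: "subspace (U0 Q)"
  unfolding U0_def
  by (intro linear_subspace_image subspace_UNIV bounded_linear.linear blinfun.bounded_linear_right)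

lemma inv_sqrt_linear: "linear_on (U0 Q) (inv_sqrt_op Q)"
  unfolding linear_on_def
proof (intro conjI ballI allI)
  fix u v assume "u \<in> U0 Q" "v \<in> U0 Q"
  then show "inv_sqrt_op Q (u + v) = inv_sqrt_op Q u + inv_sqrt_op Q v"
    using inv_sqrt[of u] inv_sqrt[of v] subspace_add[OF orth_ker_subspace]
      inv_sqrt_R[of "inv_sqrt_op Q u + inv_sqrt_op Q v"]
    by (simp add: blinfun.add_right)
next
  fix c u assume "u \<in> U0 Q"
  then show "inv_sqrt_op Q (c *\<^sub>R u) = c *\<^sub>R inv_sqrt_op Q u"
    using inv_sqrt[of u] subspace_scale[OF orth_ker_subspace]
      inv_sqrt_R[of "c *\<^sub>R inv_sqrt_op Q u"]
    by (simp add: blinfun.scaleR_right)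
qed

lemma inv_sqrt_image: "inv_sqrt_op Q ` U0 Q = orth_ker"
proof (intro subset_antisym subsetI)
  fix v assume "v \<in> orth_ker"
  then have "v = inv_sqrt_op Q (R v)" by (simp add: inv_sqrt_R)
  then show "v \<in> inv_sqrt_op Q ` U0 Q" unfolding U0_def by blast
qed (use inv_sqrt in blast)

text \<open>The pseudo-inverse maps \<open>U0 Q\<close> isometrically onto \<open>orth_ker\<close>,
  which is closed. This is the completeness of \<open>U0 Q\<close> in its own inner product.\<close>

sublocale U0: embedded_hilbert "U0 Q" "inv_sqrt_op Q"
  rewrites "embedded_hilbert.ip (inv_sqrt_op Q) = inner_U0 Q"
proof -
  show eh: "embedded_hilbert (U0 Q) (inv_sqrt_op Q)"
  proof
    show "v = 0" if "v \<in> U0 Q" "inv_sqrt_op Q v = 0" for v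
      using inv_sqrt[OF that(1)] that(2) by simp
  qed (simp_all add: U0_subspace inv_sqrt_linear inv_sqrt_image orth_ker_closed)
  show "embedded_hilbert.ip (inv_sqrt_op Q) = inner_U0 Q"
    by (simp add: fun_eq_iff inner_U0_def embedded_hilbert.ip_def[OF eh])
qed

definition E\<^sub>0 where "E\<^sub>0 = {g\<in>E. s g > 0}"

text \<open>If \<open>s g > 0\<close>, then \<open>g\<close> is the image of \<open>g\<close>
  divided by \<open>s g\<close>; conversely \<open>g = R v\<close> gives
  \<open>s g * (v \<bullet> g) = 1\<close>. This matches the condition \<open>e k \<in> U0 Q\<close>
  in the definition of elementary integrals.\<close>

lemma E0_eq: "E\<^sub>0 = E \<inter> U0 Q"
proof (intro subset_antisym subsetI IntI)
  fix g assume g: "g \<in> E\<^sub>0"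
  then show "g \<in> E" by (simp add: E\<^sub>0_def)
  have "R ((1 / s g) *\<^sub>R g) = g"
    using g by (simp add: E\<^sub>0_def blinfun.scaleR_right R_eigenvector)
  then show "g \<in> U0 Q" unfolding U0_def by (metis rangeI)
next
  fix g assume g: "g \<in> E \<inter> U0 Q"
  then obtain v where v: "g = R v" by (auto simp: U0_def)
  have "s g * (v \<bullet> g) = g \<bullet> g"
    using R_coeff[of g v] g v by simp
  also have "\<dots> = 1" using g on by simp
  finally have "s g \<noteq> 0" by auto
  then show "g \<in> E\<^sub>0" using g s_nonneg[of g] by (simp add: E\<^sub>0_def)
qed

lemma inv_sqrt_R_E0: "g \<in> E\<^sub>0 \<Longrightarrow> inv_sqrt_op Q (R g) = g"
  by (rule inv_sqrt_R) (simp add: E\<^sub>0_def orth_ker_eigenvector)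

text \<open>The pseudo-inverse takes \<open>R g\<close> back to \<open>g\<close>, which gives
  orthonormality. If \<open>v\<close> is orthogonal to all \<open>R g\<close>, its preimage is
  orthogonal to \<open>g\<close> in \<open>E\<^sub>0\<close> by assumption, and to the other
  eigenvectors because they lie in the kernel.\<close>

lemma U0_basis: "orthonormal_basis (U0 Q) (inner_U0 Q) (R ` E\<^sub>0)"
  unfolding orthonormal_basis_def
proof (intro conjI ballI impI)
  show "R ` E\<^sub>0 \<subseteq> U0 Q" by (auto simp: U0_def)
  fix f h assume "f \<in> R ` E\<^sub>0" "h \<in> R ` E\<^sub>0"
  then obtain f' h' where *: "f = R f'" "h = R h'" "f' \<in> E\<^sub>0" "h' \<in> E\<^sub>0" by blast
  then have "R f' = R h' \<longleftrightarrow> f' = h'" using inv_sqrt_R_E0 by metis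
  then show "inner_U0 Q f h = (if f = h then 1 else 0)"
    using * on by (simp add: inner_U0_def inv_sqrt_R_E0 E\<^sub>0_def)
next
  fix v assume v: "v \<in> U0 Q" "\<forall>f\<in>R ` E\<^sub>0. inner_U0 Q v f = 0"
  have "inv_sqrt_op Q v = 0"
  proof (rule eqI)
    fix g assume g: "g \<in> E"
    show "inv_sqrt_op Q v \<bullet> g = 0 \<bullet> g"
    proof (cases "s g > 0")
      case True
      then have "g \<in> E\<^sub>0" using g by (simp add: E\<^sub>0_def)
      then show ?thesis using v(2) by (simp add: inner_U0_def inv_sqrt_R_E0)
    next
      case False
      then have "R g = 0" using g s_nonneg[of g] by (simp add: R_eigenvector)
      then show ?thesis using inv_sqrt[OF v(1)] by (simp add: orth_ker_def)
    qed
  qed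
  then show "v = 0" using v(1) by (rule U0.inj[rotated])
qed

section \<open>The Hilbert-Schmidt norm, its metric and its Borel sets\<close>

abbreviation G where "G \<equiv> some_basis (U0 Q) (inner_U0 Q)"

text \<open>\<open>U0_basis\<close> is the witness that makes the choice in
  \<open>some_basis\<close> legitimate.\<close>

lemma G_basis: "orthonormal_basis (U0 Q) (inner_U0 Q) G"
  unfolding some_basis_def using U0_basis by (rule someI)

lemma G_subset: "G \<subseteq> U0 Q"
  by (rule orthonormal_basis_subset[OF G_basis])

lemma L20_D:
  assumes "B \<in> L20 Q"
  shows "B \<in> extensional (U0 Q)" "linear_on (U0 Q) B"
    "\<exists>C. \<forall>v\<in>U0 Q. norm (B v) \<le> C * norm (inv_sqrt_op Q v)"
    "(\<lambda>g. (norm (B g))\<^sup>2) summable_on G"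
  using assms unfolding L20_def hs_operators_def
  by (auto simp: inner_U0_def norm_eq_sqrt_inner)

lemma L20_norm_nonneg: "0 \<le> L20_norm Q B"
  unfolding L20_norm_def hs_norm_def by (intro real_sqrt_ge_zero infsum_nonneg) auto

lemma L20_norm_sq: "(L20_norm Q B)\<^sup>2 = (\<Sum>\<^sub>\<infinity>g\<in>G. (norm (B g))\<^sup>2)"
  unfolding L20_norm_def hs_norm_def by (intro real_sqrt_pow2 infsum_nonneg) auto

lemma L20_norm_cong: "(\<And>u. u \<in> U0 Q \<Longrightarrow> B u = C u) \<Longrightarrow> L20_norm Q B = L20_norm Q C"
  unfolding L20_norm_def hs_norm_def using G_subset
  by (intro arg_cong[where f=sqrt] infsum_cong) auto

text \<open>The unit vectors of \<open>U0 Q\<close> are \<open>R g = s g *\<^sub>R g\<close> rather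
  than \<open>g\<close>, so each term carries the factor \<open>s g * s g\<close>, the eigenvalue of
  \<open>Q\<close>. The same weight appears as the variance of a Wiener coordinate.\<close>

lemma L20_norm_sq_finite_support:
  fixes B :: "'u \<Rightarrow> 'h::real_inner"
  assumes B: "B \<in> L20 Q" and fin: "finite {g\<in>E \<inter> U0 Q. B g \<noteq> 0}"
  shows "(L20_norm Q B)\<^sup>2 = (\<Sum>g\<in>{g\<in>E \<inter> U0 Q. B g \<noteq> 0}. (blinfun_apply Q g \<bullet> g) * (norm (B g))\<^sup>2)"
proof -
  let ?K = "{g\<in>E \<inter> U0 Q. B g \<noteq> 0}"
  have K: "?K \<subseteq> E\<^sub>0" by (auto simp: E0_eq)
  have BR: "B (R g) = s g *\<^sub>R B g" if "g \<in> E\<^sub>0" for g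
    using that L20_D(2)[OF B] by (simp add: E0_eq R_eigenvector linear_on_def)
  obtain C where C: "\<And>v. v \<in> U0 Q \<Longrightarrow> norm (B v) \<le> C * norm (inv_sqrt_op Q v)"
    using L20_D(3)[OF B] by blast
  have inj: "inj_on R ?K"
    using K inv_sqrt_R_E0 by (intro inj_on_inverseI[of _ "inv_sqrt_op Q"]) blast
  have "((\<lambda>g. (norm (B g))\<^sup>2) has_sum (\<Sum>f\<in>R ` ?K. (norm (B f))\<^sup>2)) G"
  proof (rule U0.sum_norm_squares_basis_change[OF U0_basis G_basis L20_D(2)[OF B] C])
    show "finite (R ` ?K)" using fin by simp
    show "R ` ?K \<subseteq> R ` E\<^sub>0" using K by blast
    fix f assume "f \<in> R ` E\<^sub>0 - R ` ?K"
    then obtain g where "f = R g" "g \<in> E\<^sub>0" "g \<notin> ?K" by blast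
    then show "B f = 0" by (simp add: BR) (simp add: E0_eq)
  qed
  then have "(L20_norm Q B)\<^sup>2 = (\<Sum>f\<in>R ` ?K. (norm (B f))\<^sup>2)"
    unfolding L20_norm_sq by (rule infsumI)
  also have "\<dots> = (\<Sum>g\<in>?K. (norm (B (R g)))\<^sup>2)"
    using inj by (simp add: sum.reindex)
  also have "\<dots> = (\<Sum>g\<in>?K. (blinfun_apply Q g \<bullet> g) * (norm (B g))\<^sup>2)"
  proof (rule sum.cong[OF refl])
    fix g assume "g \<in> ?K"
    then have "B (R g) = s g *\<^sub>R B g" using K by (intro BR) blast
    then show "(norm (B (R g)))\<^sup>2 = (blinfun_apply Q g \<bullet> g) * (norm (B g))\<^sup>2"
      by (simp add: power_mult_distrib power2_eq_square[of "s g"] s_sq)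
  qed
  finally show ?thesis .
qed

text \<open>Minkowski's inequality for finite sums, followed by a supremum. Only summability is
  assumed, so that differences are covered: they may fail to be \<open>undefined\<close> outside
  \<open>U0 Q\<close> and thus to belong to \<open>L20 Q\<close>.\<close>

lemma L20_triangle:
  fixes B C :: "'u \<Rightarrow> 'h::real_normed_vector"
  assumes B: "(\<lambda>g. (norm (B g))\<^sup>2) summable_on G" and C: "(\<lambda>g. (norm (C g))\<^sup>2) summable_on G"
  shows "(\<lambda>g. (norm (B g + C g))\<^sup>2) summable_on G"
    and "L20_norm Q (\<lambda>u. B u + C u) \<le> L20_norm Q B + L20_norm Q C"
proof -
  have fin: "(\<Sum>g\<in>K. (norm (B g + C g))\<^sup>2) \<le> (L20_norm Q B + L20_norm Q C)\<^sup>2"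
    if K: "finite K" "K \<subseteq> G" for K
  proof -
    have le: "L2_set (\<lambda>g. norm (D g)) K \<le> L20_norm Q D"
      if "(\<lambda>g. (norm (D g))\<^sup>2) summable_on G" for D :: "'u \<Rightarrow> 'h"
      unfolding L2_set_def L20_norm_def hs_norm_def
      using that K by (intro real_sqrt_le_mono finite_sum_le_infsum) auto
    have "L2_set (\<lambda>g. norm (B g + C g)) K \<le> L2_set (\<lambda>g. norm (B g) + norm (C g)) K"
      by (intro L2_set_mono norm_triangle_ineq) auto
    also have "\<dots> \<le> L2_set (\<lambda>g. norm (B g)) K + L2_set (\<lambda>g. norm (C g)) K"
      by (rule L2_set_triangle_ineq)
    also have "\<dots> \<le> L20_norm Q B + L20_norm Q C"
      by (intro add_mono le B C)
    finally have "(L2_set (\<lambda>g. norm (B g + C g)) K)\<^sup>2 \<le> (L20_norm Q B + L20_norm Q C)\<^sup>2"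
      by (intro power_mono) (simp_all add: L2_set_nonneg)
    then show ?thesis
      by (simp add: L2_set_def sum_nonneg)
  qed
  show *: "(\<lambda>g. (norm (B g + C g))\<^sup>2) summable_on G"
    by (rule nonneg_bounded_partial_sums_imp_summable_on[of _ _ "(L20_norm Q B + L20_norm Q C)\<^sup>2"])
      (auto intro!: eventually_finite_subsets_at_top_weakI fin)
  have "(L20_norm Q (\<lambda>u. B u + C u))\<^sup>2 \<le> (L20_norm Q B + L20_norm Q C)\<^sup>2"
    unfolding L20_norm_sq using * by (rule infsum_le_finite_sums) (rule fin[unfolded L20_norm_sq])
  then show "L20_norm Q (\<lambda>u. B u + C u) \<le> L20_norm Q B + L20_norm Q C"
    by (rule power2_le_imp_le) (simp add: L20_norm_nonneg)
qed

lemma L20_norm_minus: "L20_norm Q (\<lambda>u. - B u) = L20_norm Q B"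
  by (simp add: L20_norm_def hs_norm_def)

lemma L20_diff_summable:
  fixes B C :: "'u \<Rightarrow> 'h::real_normed_vector"
  assumes "B \<in> L20 Q" "C \<in> L20 Q"
  shows "(\<lambda>g. (norm (B g - C g))\<^sup>2) summable_on G"
  using L20_triangle(1)[of B "\<lambda>u. - C u"] L20_D(4)[OF assms(1)] L20_D(4)[OF assms(2)] by simp

text \<open>The delicate point is definiteness: the norm sees only the values on \<open>G\<close>.
  These determine a bounded operator on \<open>U0 Q\<close> by \<open>operator_expansion\<close>,
  and extensionality fixes it elsewhere.\<close>

lemma L20_metric: "Metric_space (L20 Q) (\<lambda>B C :: 'u \<Rightarrow> 'h::real_normed_vector. L20_norm Q (\<lambda>u. B u - C u))"
proof
  fix B C D :: "'u \<Rightarrow> 'h"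
  show "0 \<le> L20_norm Q (\<lambda>u. B u - C u)" by (rule L20_norm_nonneg)
  show "L20_norm Q (\<lambda>u. B u - C u) = L20_norm Q (\<lambda>u. C u - B u)"
    using L20_norm_minus[of "\<lambda>u. B u - C u"] by simp
  assume B: "B \<in> L20 Q" and C: "C \<in> L20 Q"
  show "L20_norm Q (\<lambda>u. B u - C u) = 0 \<longleftrightarrow> B = C"
  proof
    assume "L20_norm Q (\<lambda>u. B u - C u) = 0"
    then have "(\<Sum>\<^sub>\<infinity>g\<in>G. (norm (B g - C g))\<^sup>2) = 0"
      by (simp flip: L20_norm_sq)
    then have eq: "B g = C g" if "g \<in> G" for g
      using nonneg_infsum_le_0D[OF _ L20_diff_summable[OF B C], of g] that by simp
    show "B = C"
    proof (rule extensionalityI[OF L20_D(1)[OF B] L20_D(1)[OF C]])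
      fix u assume u: "u \<in> U0 Q"
      have exp: "((\<lambda>g. inner_U0 Q u g *\<^sub>R D g) has_sum D u) G" if D: "D \<in> L20 Q" for D :: "'u \<Rightarrow> 'h"
      proof -
        obtain c where "\<And>v. v \<in> U0 Q \<Longrightarrow> norm (D v) \<le> c * norm (inv_sqrt_op Q v)"
          using L20_D(3)[OF D] by blast
        from U0.operator_expansion[OF G_basis L20_D(2)[OF D] this u] show ?thesis .
      qed
      have "((\<lambda>g. inner_U0 Q u g *\<^sub>R B g) has_sum C u) G"
        using exp[OF C] eq has_sum_cong[of G "\<lambda>g. inner_U0 Q u g *\<^sub>R B g" "\<lambda>g. inner_U0 Q u g *\<^sub>R C g"]
        by simp
      with exp[OF B] show "B u = C u" by (rule has_sum_unique)
    qed
  qed (simp add: L20_norm_def hs_norm_def)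
  assume D: "D \<in> L20 Q"
  show "L20_norm Q (\<lambda>u. B u - D u) \<le> L20_norm Q (\<lambda>u. B u - C u) + L20_norm Q (\<lambda>u. C u - D u)"
    using L20_triangle(2)[OF L20_diff_summable[OF B C] L20_diff_summable[OF C D]] by simp
qed

lemma zero_L20: "(\<lambda>u\<in>U0 Q. 0) \<in> L20 Q"
  using G_subset U0_subspace unfolding L20_def hs_operators_def
  by (auto simp: linear_on_def subspace_add subspace_scale subset_iff intro!: exI[of _ 0]
      summable_on_cong[THEN iffD2, OF _ summable_on_0_simp])

lemma L20_borel_space: "space (L20_borel Q) = L20 Q"
  unfolding L20_borel_def by (rule space_measure_of_conv)

text \<open>The sets where the norm is below \<open>r\<close> are open balls around the zero
  operator, and these are among the generators of \<open>L20_borel\<close>.\<close>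

lemma L20_norm_measurable:
  "L20_norm Q \<in> borel_measurable (L20_borel Q :: ('u \<Rightarrow> 'h::real_normed_vector) measure)"
proof (rule borel_measurableI_less)
  fix r
  let ?d = "\<lambda>B C :: 'u \<Rightarrow> 'h. L20_norm Q (\<lambda>u. B u - C u)"
  interpret m: Metric_space "L20 Q" ?d by (rule L20_metric)
  let ?O = "(\<lambda>u\<in>U0 Q. 0) :: 'u \<Rightarrow> 'h"
  have "L20_norm Q B = ?d ?O B" for B :: "'u \<Rightarrow> 'h"
    using L20_norm_cong[of "\<lambda>u. ?O u - B u" "\<lambda>u. - B u"] by (simp add: L20_norm_minus)
  then have "{B \<in> space (L20_borel Q). L20_norm Q B < r} = m.mball ?O r"
    by (auto simp: L20_borel_space m.in_mball zero_L20)
  moreover have "m.mball ?O r \<in> sets (L20_borel Q)"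
    unfolding L20_borel_def using openin_subset[of m.mtopology]
    by (subst sets_measure_of) (auto intro!: sigma_sets.Basic simp: m.openin_mball)
  ultimately show "{B :: 'u \<Rightarrow> 'h. B \<in> space (L20_borel Q) \<and> L20_norm Q B < r} \<in> sets (L20_borel Q)"
    by simp
qed

lemma L20_norm_compose_le:
  fixes B :: "'u \<Rightarrow> 'h::real_normed_vector"
  assumes B: "B \<in> L20 Q" and S: "norm S \<le> c"
  shows "(L20_norm Q (compose (U0 Q) (blinfun_apply S) B))\<^sup>2 \<le> c\<^sup>2 * (L20_norm Q B)\<^sup>2"
proof -
  have le: "(norm (compose (U0 Q) (blinfun_apply S) B g))\<^sup>2 \<le> c\<^sup>2 * (norm (B g))\<^sup>2" if "g \<in> G" for g
  proof -
    have "norm (blinfun_apply S (B g)) \<le> c * norm (B g)"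
      using norm_blinfun[of S "B g"] mult_right_mono[OF S norm_ge_zero[of "B g"]] by linarith
    then have "(norm (blinfun_apply S (B g)))\<^sup>2 \<le> (c * norm (B g))\<^sup>2"
      by (intro power_mono) auto
    then show ?thesis
      using that G_subset by (auto simp: compose_def power_mult_distrib subset_iff)
  qed
  have sum: "(\<lambda>g. c\<^sup>2 * (norm (B g))\<^sup>2) summable_on G"
    using L20_D(4)[OF B] by (rule summable_on_cmult_right)
  have "(\<Sum>\<^sub>\<infinity>g\<in>G. (norm (compose (U0 Q) (blinfun_apply S) B g))\<^sup>2) \<le> (\<Sum>\<^sub>\<infinity>g\<in>G. c\<^sup>2 * (norm (B g))\<^sup>2)"
    by (rule infsum_mono[OF summable_on_comparison_test[OF sum] sum]) (use le in auto)
  also have "\<dots> = c\<^sup>2 * (\<Sum>\<^sub>\<infinity>g\<in>G. (norm (B g))\<^sup>2)"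
    by (rule infsum_cmult_right')
  finally show ?thesis by (simp add: L20_norm_sq)
qed

end

section \<open>Uniform boundedness of the resolvent\<close>

text \<open>Banach-Steinhaus by Baire category: the closed sets \<open>A n\<close> cover the space,
  so one of them contains a ball.\<close>

lemma uniform_boundedness_principle:
  fixes F :: "('a::banach \<Rightarrow>\<^sub>L 'b::real_normed_vector) set"
  assumes bd: "\<And>x. \<exists>c. \<forall>f\<in>F. norm (blinfun_apply f x) \<le> c"
  shows "\<exists>c. \<forall>f\<in>F. norm f \<le> c"
proof -
  define A where "A n = {x. \<forall>f\<in>F. norm (blinfun_apply f x) \<le> real n}" for n :: nat
  have closed: "closed (A n)" for n
  proof -
    have "A n = (\<Inter>f\<in>F. {x. norm (blinfun_apply f x) \<le> real n})"
      by (auto simp: A_def)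
    also have "closed \<dots>"
      by (intro closed_INT ballI closed_Collect_le continuous_intros)
    finally show ?thesis .
  qed
  have UN: "(\<Union>n. A n) = UNIV"
  proof (intro set_eqI iffI UNIV_I)
    fix x
    obtain c where c: "\<forall>f\<in>F. norm (blinfun_apply f x) \<le> c" using bd by blast
    obtain n :: nat where "c \<le> real n" using real_arch_simple by blast
    then have "x \<in> A n" using c by (force simp: A_def)
    then show "x \<in> (\<Union>n. A n)" by blast
  qed
  have "\<exists>n. interior (A n) \<noteq> {}"
  proof (rule ccontr)
    assume "\<nexists>n. interior (A n) \<noteq> {}"
    then have "euclidean interior_of \<Union>(range A) = {}"
      using completely_metrizable_space_euclidean closed
      by (intro Baire_category_alt) auto
    then show False using UN by simp
  qed
  then obtain n x0 r where r: "r > 0" "cball x0 r \<subseteq> A n"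
    by (metis all_not_in_conv mem_interior_cball)
  \<comment> \<open>A vector \<open>y\<close> of length \<open>r\<close> is the difference of
    \<open>x0 + y\<close> and \<open>x0\<close>, both in the ball, where \<open>f\<close> is bounded
    by \<open>n\<close>. Rescaling to an arbitrary \<open>x\<close> gives
    \<open>2 * n / r\<close>.\<close>
  have "norm f \<le> 2 * real n / r" if f: "f \<in> F" for f
  proof (rule norm_blinfun_bound)
    show "0 \<le> 2 * real n / r" using r by simp
    fix x
    show "norm (blinfun_apply f x) \<le> 2 * real n / r * norm x"
    proof (cases "x = 0")
      case False
      define y where "y = (r / norm x) *\<^sub>R x"
      have "norm y = r" using False r by (simp add: y_def)
      then have "x0 \<in> A n" "x0 + y \<in> A n"
        using r by (auto simp: dist_norm subset_iff)
      then have "norm (blinfun_apply f x0) \<le> n" "norm (blinfun_apply f (x0 + y)) \<le> n"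
        using f by (auto simp: A_def)
      then have "norm (blinfun_apply f y) \<le> 2 * real n"
        using norm_triangle_ineq4[of "blinfun_apply f (x0 + y)" "blinfun_apply f x0"]
        by (simp add: blinfun.add_right)
      then show ?thesis
        using False r by (simp add: y_def blinfun.scaleR_right field_simps)
    qed simp
  qed
  then show ?thesis by blast
qed

text \<open>The resolvent is only strongly continuous. Each orbit is therefore bounded on the
  compact interval, and uniform boundedness turns this into a bound on the operator norms.\<close>

lemma resolvent_bounded:
  assumes S: "resolvent DA A a S"
  obtains c where "c \<ge> 0" "\<And>t. t \<in> {0..T} \<Longrightarrow> norm (S t) \<le> c"
proof -
  have "\<exists>c. \<forall>f\<in>S ` {0..T}. norm (blinfun_apply f x) \<le> c" for x
  proof -
    have "continuous_on {0..T} (\<lambda>t. blinfun_apply (S t) x)"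
      using S continuous_on_subset[of "{0..}" "\<lambda>t. blinfun_apply (S t) x" "{0..T}"]
      by (auto simp: resolvent_def)
    then have "compact ((\<lambda>t. blinfun_apply (S t) x) ` {0..T})"
      by (intro compact_continuous_image) auto
    then have "bounded ((\<lambda>t. blinfun_apply (S t) x) ` {0..T})"
      by (rule compact_imp_bounded)
    then show ?thesis
      by (auto simp: bounded_iff)
  qed
  from uniform_boundedness_principle[OF this] obtain c where "\<forall>f\<in>S ` {0..T}. norm f \<le> c" ..
  \<comment> \<open>For \<open>T < 0\<close> the interval is empty and \<open>c\<close> may be
    negative, hence the maximum with 0.\<close>
  then show ?thesis
    by (intro that[of "max c 0"]) (auto simp: le_max_iff_disj)
qed

section \<open>Predictable processes\<close>

lemma normal_filtration_D:
  assumes "normal_filtration M F" "0 \<le> t"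
  shows "subalgebra M (F t)" "t \<le> t' \<Longrightarrow> sets (F t) \<subseteq> sets (F t')"
proof -
  note F = assms(1)[unfolded normal_filtration_def]
  show "subalgebra M (F t)"
    using F[THEN conjunct1] assms(2) by simp
  show "sets (F t) \<subseteq> sets (F t')" if "t \<le> t'"
    using F[THEN conjunct2, THEN conjunct1] assms(2) that by simp
qed

lemma filtration_measurable:
  assumes F: "normal_filtration M F" "0 \<le> t" and X: "X \<in> F t \<rightarrow>\<^sub>M N"
  shows "X \<in> M \<rightarrow>\<^sub>M N" "t \<le> t' \<Longrightarrow> X \<in> F t' \<rightarrow>\<^sub>M N"
proof -
  show "X \<in> M \<rightarrow>\<^sub>M N"
    using measurable_from_subalg[OF normal_filtration_D(1)[OF F] X] .
  assume t: "t \<le> t'"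
  have "subalgebra (F t') (F t)"
    using normal_filtration_D[OF F] normal_filtration_D(1)[OF F(1), of t'] F(2) t
    by (auto simp: subalgebra_def)
  from measurable_from_subalg[OF this X] show "X \<in> F t' \<rightarrow>\<^sub>M N" .
qed

text \<open>Every generator of the predictable sets is a measurable rectangle, so the identity map
  is measurable from the restricted product space to the predictable one.\<close>

lemma predictable_process_restrict_space:
  assumes F: "normal_filtration M F" and T: "0 \<le> T" and X: "predictable_process M F T N X"
  shows "(\<lambda>(t, \<omega>). X t \<omega>) \<in> restrict_space (lborel \<Otimes>\<^sub>M M) ({0..T} \<times> space M) \<rightarrow>\<^sub>M N"
proof -
  let ?\<Omega> = "{0..T} \<times> space M"
  have \<Omega>: "?\<Omega> \<in> sets (lborel \<Otimes>\<^sub>M M)" by simp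
  have sub: "A \<in> sets M" if "0 \<le> t" "A \<in> sets (F t)" for A t
    using normal_filtration_D(1)[OF F that(1)] that(2) by (auto simp: subalgebra_def)
  have sub': "A \<subseteq> space M" if "0 \<le> t" "A \<in> sets (F t)" for A t
    using sub[OF that] by (rule sets.sets_into_space)
  have "(\<lambda>x. x) \<in> restrict_space (lborel \<Otimes>\<^sub>M M) ?\<Omega> \<rightarrow>\<^sub>M predictable_algebra M F T"
    unfolding predictable_algebra_def
  proof (rule measurable_measure_of)
    fix B assume B: "B \<in> {{s<..t} \<times> A |s t A. 0 \<le> s \<and> s < t \<and> t \<le> T \<and> A \<in> sets (F s)} \<union>
        {{0} \<times> A |A. A \<in> sets (F 0)}"
    then have "B \<in> sets (lborel \<Otimes>\<^sub>M M)"
      using sub sub[OF order_refl] by (auto intro!: pair_measureI)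
    then have "B \<inter> ?\<Omega> \<in> sets (restrict_space (lborel \<Otimes>\<^sub>M M) ?\<Omega>)"
      using \<Omega> by (auto simp: sets_restrict_space)
    then show "(\<lambda>x. x) -` B \<inter> space (restrict_space (lborel \<Otimes>\<^sub>M M) ?\<Omega>)
        \<in> sets (restrict_space (lborel \<Otimes>\<^sub>M M) ?\<Omega>)"
      by (simp add: space_restrict_space space_pair_measure Times_Int_Times)
  next
    show "{{s<..t} \<times> A |s t A. 0 \<le> s \<and> s < t \<and> t \<le> T \<and> A \<in> sets (F s)} \<union>
        {{0} \<times> A |A. A \<in> sets (F 0)} \<subseteq> Pow ?\<Omega>"
      using sub' T by fastforce
  qed (auto simp: space_restrict_space space_pair_measure)
  from measurable_compose[OF this X[unfolded predictable_process_def]] show ?thesis .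
qed

section \<open>Gaussian moments and independence of the past\<close>

text \<open>The case \<open>v = 0\<close> arises for a zero eigenvalue and for an increment over an
  empty interval. The law then has no density, but \<open>X\<close> vanishes almost surely.\<close>

lemma (in prob_space) centred_gaussian_moments:
  assumes X: "X \<in> borel_measurable M" and D: "distr M borel X = centred_gaussian v" and v: "0 \<le> v"
  shows "integrable M X" "expectation X = 0"
    "integrable M (\<lambda>\<omega>. (X \<omega>)\<^sup>2)" "expectation (\<lambda>\<omega>. (X \<omega>)\<^sup>2) = v"
proof -
  have "integrable M X \<and> expectation X = 0 \<and>
      integrable M (\<lambda>\<omega>. (X \<omega>)\<^sup>2) \<and> expectation (\<lambda>\<omega>. (X \<omega>)\<^sup>2) = v"
  proof (cases "v = 0")
    case True
    then have "AE x in distr M borel X. x = 0"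
      unfolding D centred_gaussian_def by (simp add: AE_return)
    then have AE: "AE \<omega> in M. X \<omega> = 0"
      using X by (subst (asm) AE_distr_iff) auto
    then have "AE \<omega> in M. (X \<omega>)\<^sup>2 = 0" by simp
    with AE show ?thesis
      using X True integrable_cong_AE[of X M "\<lambda>_. 0"] integral_cong_AE[of X M "\<lambda>_. 0"]
        integrable_cong_AE[of "\<lambda>\<omega>. (X \<omega>)\<^sup>2" M "\<lambda>_. 0"] integral_cong_AE[of "\<lambda>\<omega>. (X \<omega>)\<^sup>2" M "\<lambda>_. 0"]
      by simp
  next
    case False
    then have pos: "0 < sqrt v" using v by simp
    have dist: "distributed M lborel X (normal_density 0 (sqrt v))"
      using X D False by (simp add: distributed_def centred_gaussian_def cong: distr_cong)
    have int: "integrable M (\<lambda>\<omega>. X \<omega> ^ k)" for k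
      using distributed_integrable[OF dist, of "\<lambda>x. x ^ k"] integrable_normal_moment[OF pos, of 0 k]
      by simp
    have exp: "expectation X = 0"
      using normal_distributed_expectation[OF pos dist] .
    moreover have "expectation (\<lambda>\<omega>. (X \<omega>)\<^sup>2) = v"
      using normal_distributed_variance[OF pos dist] exp v by simp
    ultimately show ?thesis using int[of 1] int[of 2] by simp
  qed
  then show "integrable M X" "expectation X = 0"
    "integrable M (\<lambda>\<omega>. (X \<omega>)\<^sup>2)" "expectation (\<lambda>\<omega>. (X \<omega>)\<^sup>2) = v" by auto
qed

text \<open>The sigma-algebras generated by \<open>Y\<close> and by \<open>f (X \<omega>)\<close>
  lie inside those of \<open>G\<close> and of \<open>X\<close>, so independence descends to them. A
  general \<open>f\<close> admits products of two coordinates of a vector of increments.\<close>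

lemma (in prob_space) indep_of_past_mult:
  fixes Y :: "'a \<Rightarrow> real" and f :: "'e \<Rightarrow> real"
  assumes G: "subalgebra M G" and Y: "Y \<in> borel_measurable G" "integrable M Y"
    and X: "X \<in> M \<rightarrow>\<^sub>M N" and indep: "indep_of_past M G N X"
    and f: "f \<in> borel_measurable N" "integrable M (\<lambda>\<omega>. f (X \<omega>))"
  shows "integrable M (\<lambda>\<omega>. Y \<omega> * f (X \<omega>))"
    "expectation (\<lambda>\<omega>. Y \<omega> * f (X \<omega>)) = expectation Y * expectation (\<lambda>\<omega>. f (X \<omega>))"
proof -
  have sp: "space G = space M" using G by (auto simp: subalgebra_def)
  have XV: "X \<in> space M \<rightarrow> space N" using X by (auto simp: measurable_def)
  have ind: "indep_set (sets G) (sets (vimage_algebra (space M) X N))"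
    using indep by (simp add: indep_of_past_def)
  have Ysub: "sigma_sets (space M) {Y -` A \<inter> space M |A. A \<in> sets borel} \<subseteq> sets G"
    unfolding sp[symmetric]
    by (rule sets.sigma_sets_subset) (auto intro!: measurable_sets[OF Y(1)])
  have fX: "(\<lambda>\<omega>. f (X \<omega>)) \<in> borel_measurable (vimage_algebra (space M) X N)"
    by (rule measurable_compose[OF measurable_vimage_algebra1[OF XV] f(1)])
  have Xsub: "sigma_sets (space M) {(\<lambda>\<omega>. f (X \<omega>)) -` A \<inter> space M |A. A \<in> sets borel}
      \<subseteq> sets (vimage_algebra (space M) X N)"
    using sets.sigma_sets_subset[of "{(\<lambda>\<omega>. f (X \<omega>)) -` A \<inter> space M |A. A \<in> sets borel}"
        "vimage_algebra (space M) X N"] measurable_sets[OF fX]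
    by (simp add: subset_iff) blast
  have "indep_var borel Y borel (\<lambda>\<omega>. f (X \<omega>))"
    unfolding indep_var_eq
  proof (intro conjI)
    show "random_variable borel Y" using Y(1) G by (metis measurable_from_subalg)
    show "random_variable borel (\<lambda>\<omega>. f (X \<omega>))" by (rule measurable_compose[OF X f(1)])
    show "indep_set (sigma_sets (space M) {Y -` A \<inter> space M |A. A \<in> sets borel})
        (sigma_sets (space M) {(\<lambda>\<omega>. f (X \<omega>)) -` A \<inter> space M |A. A \<in> sets borel})"
      using ind Ysub Xsub unfolding indep_sets2_eq by blast
  qed
  then show "integrable M (\<lambda>\<omega>. Y \<omega> * f (X \<omega>))"
    "expectation (\<lambda>\<omega>. Y \<omega> * f (X \<omega>)) = expectation Y * expectation (\<lambda>\<omega>. f (X \<omega>))"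
    using Y(2) f(2) by (auto intro: indep_var_integrable indep_var_lebesgue_integral)
qed

section \<open>The It\^o isometry for elementary processes\<close>

lemma partition_mono:
  fixes p :: "nat \<Rightarrow> real"
  assumes "\<And>m. m < n \<Longrightarrow> p m < p (Suc m)" and "i \<le> j" "j \<le> n"
  shows "p i \<le> p j"
  using assms(2,3)
proof (induction j rule: dec_induct)
  case (step j)
  then show ?case using assms(1)[of j] by simp
qed simp

locale cylindrical_noise = prob_space M
  for M :: "'w measure" and F :: "real \<Rightarrow> 'w measure"
    and Q :: "'u::{real_inner, banach} \<Rightarrow>\<^sub>L 'u"
    and I :: "nat set" and e :: "nat \<Rightarrow> 'u" and lam :: "nat \<Rightarrow> real"
    and \<beta> :: "nat \<Rightarrow> real \<Rightarrow> 'w \<Rightarrow> real" +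
  assumes F: "normal_filtration M F" and Q: "nonneg_op Q"
    and W: "cylindrical_wiener M F Q I e lam \<beta>"
begin

lemma cylindrical_wiener_D:
  shows inj_e: "inj_on e I" and basis_e: "orthonormal_basis UNIV (\<bullet>) (e ` I)"
    and Q_e: "\<And>k. k \<in> I \<Longrightarrow> blinfun_apply Q (e k) = lam k *\<^sub>R e k"
    and wiener_coordinate: "\<And>k. k \<in> I \<Longrightarrow> real_wiener M F (lam k) (\<beta> k)"
    and indep_coordinates:
      "indep_vars (\<lambda>_. Pi\<^sub>M {0..} (\<lambda>_. borel)) (\<lambda>k \<omega>. \<lambda>t\<in>{0..}. \<beta> k t \<omega>) I"
    and indep_increments: "\<And>s t. 0 \<le> s \<Longrightarrow> s \<le> t \<Longrightarrow> indep_of_past M (F s)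
        (Pi\<^sub>M I (\<lambda>_. borel)) (\<lambda>\<omega>. \<lambda>k\<in>I. \<beta> k t \<omega> - \<beta> k s \<omega>)"
proof -
  note W' = W[unfolded cylindrical_wiener_def]
  show "inj_on e I" using W' by (rule conjunct1)
  note W' = W'[THEN conjunct2]
  show "orthonormal_basis UNIV (\<bullet>) (e ` I)" using W' by (rule conjunct1)
  note W' = W'[THEN conjunct2]
  show "\<And>k. k \<in> I \<Longrightarrow> blinfun_apply Q (e k) = lam k *\<^sub>R e k"
    using W'[THEN conjunct1] by (rule bspec)
  note W' = W'[THEN conjunct2]
  show "\<And>k. k \<in> I \<Longrightarrow> real_wiener M F (lam k) (\<beta> k)"
    using W'[THEN conjunct1] by (rule bspec)
  note W' = W'[THEN conjunct2]
  show "indep_vars (\<lambda>_. Pi\<^sub>M {0..} (\<lambda>_. borel)) (\<lambda>k \<omega>. \<lambda>t\<in>{0..}. \<beta> k t \<omega>) I"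
    using W' by (rule conjunct1)
  show "\<And>s t. 0 \<le> s \<Longrightarrow> s \<le> t \<Longrightarrow> indep_of_past M (F s)
        (Pi\<^sub>M I (\<lambda>_. borel)) (\<lambda>\<omega>. \<lambda>k\<in>I. \<beta> k t \<omega> - \<beta> k s \<omega>)"
    using W'[THEN conjunct2] by simp
qed

lemma norm_e: "k \<in> I \<Longrightarrow> e k \<bullet> e k = 1"
  using orthonormal_basis_ip[OF basis_e, of "e k" "e k"] by simp

lemma lam_eq: "k \<in> I \<Longrightarrow> blinfun_apply Q (e k) \<bullet> e k = lam k"
  by (simp add: Q_e norm_e)

lemma lam_nonneg: "k \<in> I \<Longrightarrow> 0 \<le> lam k"
  using nonneg_op_D(2)[OF Q, of "e k"] lam_eq by simp

sublocale dop: diagonal_op Q "e ` I"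
proof
  fix g assume "g \<in> e ` I"
  then show "blinfun_apply Q g = (blinfun_apply Q g \<bullet> g) *\<^sub>R g"
    by (auto simp: lam_eq Q_e norm_e)
qed (fact Q basis_e)+

lemma wiener_measurable:
  assumes "k \<in> I" "0 \<le> t"
  shows "\<beta> k t \<in> borel_measurable (F t)"
  using wiener_coordinate[OF assms(1)] assms(2) unfolding real_wiener_def by blast

section \<open>Moments of Wiener increments and of their products with past variables\<close>

definition incr where "incr s t k \<omega> = \<beta> k t \<omega> - \<beta> k s \<omega>"

lemma incr_measurable:
  assumes "k \<in> I" "0 \<le> s" "s \<le> t"
  shows "incr s t k \<in> borel_measurable (F t)" "incr s t k \<in> borel_measurable M"
proof -
  show *: "incr s t k \<in> borel_measurable (F t)"
    using wiener_measurable[OF assms(1), of t] assms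
      filtration_measurable(2)[OF F assms(2) wiener_measurable[OF assms(1,2)] assms(3)]
    unfolding incr_def by (intro borel_measurable_diff) auto
  show "incr s t k \<in> borel_measurable M"
    using assms by (intro filtration_measurable(1)[OF F _ *]) auto
qed

lemma incr_moments:
  assumes "k \<in> I" "0 \<le> s" "s \<le> t"
  shows "integrable M (incr s t k)" "expectation (incr s t k) = 0"
    "integrable M (\<lambda>\<omega>. (incr s t k \<omega>)\<^sup>2)" "expectation (\<lambda>\<omega>. (incr s t k \<omega>)\<^sup>2) = lam k * (t - s)"
proof -
  have D: "distr M borel (incr s t k) = centred_gaussian (lam k * (t - s))"
    using wiener_coordinate[OF assms(1)] assms(2,3) unfolding real_wiener_def incr_def by blast
  have v: "0 \<le> lam k * (t - s)" using lam_nonneg assms by simp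
  show "integrable M (incr s t k)" "expectation (incr s t k) = 0"
    "integrable M (\<lambda>\<omega>. (incr s t k \<omega>)\<^sup>2)" "expectation (\<lambda>\<omega>. (incr s t k \<omega>)\<^sup>2) = lam k * (t - s)"
    by (rule centred_gaussian_moments[OF incr_measurable(2)[OF assms] D v])+
qed

lemma incr_mult_integrable:
  assumes "k \<in> I" "l \<in> I" "0 \<le> s" "s \<le> t" "0 \<le> s'" "s' \<le> t'"
  shows "integrable M (\<lambda>\<omega>. incr s t k \<omega> * incr s' t' l \<omega>)"
proof (rule Bochner_Integration.integrable_bound)
  show "integrable M (\<lambda>\<omega>. (incr s t k \<omega>)\<^sup>2 + (incr s' t' l \<omega>)\<^sup>2)"
    using assms by (intro Bochner_Integration.integrable_add incr_moments)
  show "(\<lambda>\<omega>. incr s t k \<omega> * incr s' t' l \<omega>) \<in> borel_measurable M"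
    using assms by (intro borel_measurable_times incr_measurable(2))
  have "\<bar>a * b\<bar> \<le> a\<^sup>2 + b\<^sup>2" for a b :: real
    using sum_squares_bound[of "\<bar>a\<bar>" "\<bar>b\<bar>"] mult_nonneg_nonneg[OF abs_ge_zero abs_ge_zero, of a b]
    by (simp only: abs_mult power2_abs mult.assoc)
  then show "AE \<omega> in M. norm (incr s t k \<omega> * incr s' t' l \<omega>)
      \<le> norm ((incr s t k \<omega>)\<^sup>2 + (incr s' t' l \<omega>)\<^sup>2)"
    by simp
qed

text \<open>For distinct coordinates, each increment is a measurable function of its own path, so
  independence of the paths gives a product of vanishing means.\<close>

lemma incr_covariance:
  assumes k: "k \<in> I" "l \<in> I" and s: "0 \<le> s" "s \<le> t"
  shows "expectation (\<lambda>\<omega>. incr s t k \<omega> * incr s t l \<omega>) = (if k = l then lam k * (t - s) else 0)"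
proof (cases "k = l")
  case True
  then show ?thesis using incr_moments(4)[OF k(1) s] by (simp add: power2_eq_square)
next
  case False
  have "indep_vars (\<lambda>_. borel) (\<lambda>k \<omega>. (\<lambda>x. x t - x s) (\<lambda>t\<in>{0..}. \<beta> k t \<omega>)) {k, l}"
    using s k by (intro indep_vars_compose2[OF indep_vars_subset[OF indep_coordinates]]
        borel_measurable_diff measurable_component_singleton) auto
  then have "indep_vars (\<lambda>_. borel) (incr s t) {k, l}"
    using s by (simp add: incr_def[abs_def])
  then have "expectation (\<lambda>\<omega>. \<Prod>i\<in>{k, l}. incr s t i \<omega>) = (\<Prod>i\<in>{k, l}. expectation (incr s t i))"
    using k s by (intro indep_vars_lebesgue_integral) (auto intro: incr_moments(1))
  then show ?thesis
    using False incr_moments(2)[OF k(1) s] by simp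
qed

lemma past_times_incr:
  assumes k: "k \<in> I" and s: "0 \<le> s" "s \<le> t"
    and Y: "Y \<in> borel_measurable (F s)" "integrable M Y"
  shows "integrable M (\<lambda>\<omega>. Y \<omega> * incr s t k \<omega>)" "expectation (\<lambda>\<omega>. Y \<omega> * incr s t k \<omega>) = 0"
proof -
  let ?X = "\<lambda>\<omega>. \<lambda>k\<in>I. incr s t k \<omega>"
  have X: "?X \<in> M \<rightarrow>\<^sub>M Pi\<^sub>M I (\<lambda>_. borel)"
    using s by (intro measurable_restrict incr_measurable(2))
  have f: "(\<lambda>x. x k) \<in> borel_measurable (Pi\<^sub>M I (\<lambda>_. borel :: real measure))"
    using k by (rule measurable_component_singleton)
  have int: "integrable M (\<lambda>\<omega>. ?X \<omega> k)" using k s incr_moments(1) by simp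
  note * = indep_of_past_mult[where f="\<lambda>x. x k" and X="?X", OF normal_filtration_D(1)[OF F s(1)] Y X indep_increments[OF s, folded incr_def] f int]
  show "integrable M (\<lambda>\<omega>. Y \<omega> * incr s t k \<omega>)"
    using *(1) k by simp
  show "expectation (\<lambda>\<omega>. Y \<omega> * incr s t k \<omega>) = 0"
    using *(2) k incr_moments(2)[OF k s] by simp
qed

text \<open>For \<open>k \<noteq> l\<close>, independence of each single coordinate from the past
  would not be enough; the joint independence of the vector of increments enters here.\<close>

lemma past_times_incr_mult:
  assumes k: "k \<in> I" "l \<in> I" and s: "0 \<le> s" "s \<le> t"
    and Y: "Y \<in> borel_measurable (F s)" "integrable M Y"
  shows "integrable M (\<lambda>\<omega>. Y \<omega> * (incr s t k \<omega> * incr s t l \<omega>))"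
    "expectation (\<lambda>\<omega>. Y \<omega> * (incr s t k \<omega> * incr s t l \<omega>)) =
      (if k = l then lam k * (t - s) * expectation Y else 0)"
proof -
  let ?X = "\<lambda>\<omega>. \<lambda>k\<in>I. incr s t k \<omega>"
  have X: "?X \<in> M \<rightarrow>\<^sub>M Pi\<^sub>M I (\<lambda>_. borel)"
    using s by (intro measurable_restrict incr_measurable(2))
  have f: "(\<lambda>x. x k * x l) \<in> borel_measurable (Pi\<^sub>M I (\<lambda>_. borel :: real measure))"
    using k by (intro borel_measurable_times measurable_component_singleton)
  have int: "integrable M (\<lambda>\<omega>. ?X \<omega> k * ?X \<omega> l)"
    using k s incr_mult_integrable[of k l s t s t] by simp
  note * = indep_of_past_mult[where f="\<lambda>x. x k * x l" and X="?X", OF normal_filtration_D(1)[OF F s(1)] Y X indep_increments[OF s, folded incr_def] f int]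
  show "integrable M (\<lambda>\<omega>. Y \<omega> * (incr s t k \<omega> * incr s t l \<omega>))"
    using *(1) k by simp
  show "expectation (\<lambda>\<omega>. Y \<omega> * (incr s t k \<omega> * incr s t l \<omega>)) =
      (if k = l then lam k * (t - s) * expectation Y else 0)"
    using *(2) k incr_covariance[OF k s] by simp
qed

text \<open>The squared norm is a double sum over pairs of a time step and a coordinate. Pairs with
  different time steps vanish in expectation because the later increment is centred and independent
  of all the other factors; for equal steps the covariance of the increments leaves the
  diagonal.\<close>

lemma ito_isometry_finite:
  fixes \<theta> :: "nat \<Rightarrow> nat \<Rightarrow> 'w \<Rightarrow> 'h::{real_inner, second_countable_topology}"
  assumes K: "finite K" "K \<subseteq> I" and p: "0 \<le> p 0" "\<And>m. m < n \<Longrightarrow> p m < p (Suc m)"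
    and \<theta>: "\<And>m k. m < n \<Longrightarrow> k \<in> K \<Longrightarrow> \<theta> m k \<in> borel_measurable (F (p m))"
    and bd: "\<And>m k. m < n \<Longrightarrow> k \<in> K \<Longrightarrow> \<exists>C. \<forall>\<omega>\<in>space M. norm (\<theta> m k \<omega>) \<le> C"
  defines "X \<equiv> \<lambda>\<omega>. \<Sum>m<n. \<Sum>k\<in>K. incr (p m) (p (Suc m)) k \<omega> *\<^sub>R \<theta> m k \<omega>"
  shows "X \<in> borel_measurable M" "integrable M (\<lambda>\<omega>. (norm (X \<omega>))\<^sup>2)"
    "expectation (\<lambda>\<omega>. (norm (X \<omega>))\<^sup>2) =
      (\<Sum>m<n. \<Sum>k\<in>K. lam k * (p (Suc m) - p m) * expectation (\<lambda>\<omega>. (norm (\<theta> m k \<omega>))\<^sup>2))"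
proof -
  note p_mono = partition_mono[where n=n and p=p, OF p(2)]
  have p_nonneg: "0 \<le> p m" if "m \<le> n" for m
    using p_mono[of 0 m] that p(1) by simp
  have \<xi>: "k \<in> I" "0 \<le> p m" "p m \<le> p (Suc m)" if "m < n" "k \<in> K" for m k
    using that K p(2)[of m] p_nonneg[of m] by auto
  have \<theta>M: "\<theta> m k \<in> borel_measurable M" if "m < n" "k \<in> K" for m k
    using filtration_measurable(1)[OF F \<xi>(2)[OF that] \<theta>[OF that]] .
  define c where "c a = lam (snd a) * (p (Suc (fst a)) - p (fst a)) *
      expectation (\<lambda>\<omega>. (norm (\<theta> (fst a) (snd a) \<omega>))\<^sup>2)" for a
  define A where "A = {..<n} \<times> K"
  define T where "T a b \<omega> = (incr (p (fst a)) (p (Suc (fst a))) (snd a) \<omega> *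
      incr (p (fst b)) (p (Suc (fst b))) (snd b) \<omega>) * (\<theta> (fst a) (snd a) \<omega> \<bullet> \<theta> (fst b) (snd b) \<omega>)"
    for a b \<omega>
  have finA: "finite A" using K by (simp add: A_def)
  \<comment> \<open>Bounded coefficients keep every product as integrable as its increment
    factor.\<close>
  have inner: "integrable M (\<lambda>\<omega>. Z \<omega> * (\<theta> m k \<omega> \<bullet> \<theta> m' k' \<omega>))"
    if Z: "integrable M Z" and mk: "m < n" "k \<in> K" "m' < n" "k' \<in> K" for Z :: "'w \<Rightarrow> real" and m k m' k'
  proof -
    obtain C where C: "\<And>\<omega>. \<omega> \<in> space M \<Longrightarrow> norm (\<theta> m k \<omega>) \<le> C" using bd[OF mk(1,2)] by blast
    obtain C' where C': "\<And>\<omega>. \<omega> \<in> space M \<Longrightarrow> norm (\<theta> m' k' \<omega>) \<le> C'" using bd[OF mk(3,4)] by blast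
    have C'': "norm (\<theta> m k \<omega> \<bullet> \<theta> m' k' \<omega>) \<le> C * C'" if "\<omega> \<in> space M" for \<omega>
      using Cauchy_Schwarz_ineq2[of "\<theta> m k \<omega>" "\<theta> m' k' \<omega>"]
        mult_mono[OF C[OF that] C'[OF that]] C[OF that] norm_ge_zero[of "\<theta> m k \<omega>"] by simp
    show ?thesis
    proof (rule Bochner_Integration.integrable_bound)
      show "integrable M (\<lambda>\<omega>. C * C' * Z \<omega>)" using Z by simp
      show "(\<lambda>\<omega>. Z \<omega> * (\<theta> m k \<omega> \<bullet> \<theta> m' k' \<omega>)) \<in> borel_measurable M"
        using Z \<theta>M mk by measurable
      show "AE \<omega> in M. norm (Z \<omega> * (\<theta> m k \<omega> \<bullet> \<theta> m' k' \<omega>)) \<le> norm (C * C' * Z \<omega>)"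
      proof (rule AE_I2)
        fix \<omega> assume "\<omega> \<in> space M"
        from mult_left_mono[OF C''[OF this] norm_ge_zero[of "Z \<omega>"]]
          order_trans[OF norm_ge_zero C''[OF this]]
        show "norm (Z \<omega> * (\<theta> m k \<omega> \<bullet> \<theta> m' k' \<omega>)) \<le> norm (C * C' * Z \<omega>)"
          by (simp add: abs_mult[of _ "Z \<omega>"] abs_mult[of "Z \<omega>"] abs_of_nonneg mult.commute)
      qed
    qed
  qed
  \<comment> \<open>The order of the time steps decides which increment is independent of the rest.
    The opposite order follows from the symmetry of \<open>T\<close>.\<close>
  have cross: "integrable M (T a b) \<and> expectation (T a b) = (if a = b then c a else 0)"
    if a: "a \<in> A" and b: "b \<in> A" and le: "fst a \<le> fst b" for a b
  proof -
    obtain m k where a': "a = (m, k)" "m < n" "k \<in> K" using a by (auto simp: A_def)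
    obtain m' l where b': "b = (m', l)" "m' < n" "l \<in> K" using b by (auto simp: A_def)
    note k = \<xi>[OF a'(2,3)] and l = \<xi>[OF b'(2,3)]
    have mea: "(\<lambda>\<omega>. \<theta> m k \<omega> \<bullet> \<theta> m' l \<omega>) \<in> borel_measurable (F (p m'))"
      using filtration_measurable(2)[OF F k(2) \<theta>[OF a'(2,3)] p_mono[of m m']] \<theta>[OF b'(2,3)] le a' b'
      by (intro borel_measurable_inner) auto
    show ?thesis
    proof (cases "m = m'")
      case True
      have int: "integrable M (\<lambda>\<omega>. \<theta> m k \<omega> \<bullet> \<theta> m' l \<omega>)"
        using inner[of "\<lambda>_. 1" m k m' l] a' b' by simp
      have T: "T a b = (\<lambda>\<omega>. (\<theta> m k \<omega> \<bullet> \<theta> m' l \<omega>) *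
          (incr (p m') (p (Suc m')) k \<omega> * incr (p m') (p (Suc m')) l \<omega>))"
        by (simp add: T_def a' b' True fun_eq_iff mult.commute)
      show ?thesis
        unfolding T using past_times_incr_mult[OF k(1) l(1) l(2,3) mea int]
        by (auto simp: a' b' True c_def power2_norm_eq_inner)
    next
      case False
      then have less: "m < m'" using le a' b' by simp
      \<comment> \<open>All factors known at the start \<open>p m'\<close> of the later step. The
        earlier increment is among them because it ends at
        \<open>p (Suc m) \<le> p m'\<close>.\<close>
      define Y where "Y \<omega> = incr (p m) (p (Suc m)) k \<omega> * (\<theta> m k \<omega> \<bullet> \<theta> m' l \<omega>)" for \<omega>
      have "Y \<in> borel_measurable (F (p m'))"
        unfolding Y_def
        using filtration_measurable(2)[OF F _ incr_measurable(1)[OF k] p_mono[of "Suc m" m']]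
          p_nonneg[of "Suc m"] less b' a'
        by (intro borel_measurable_times mea) auto
      moreover have "integrable M Y"
        unfolding Y_def using a' b' k by (intro inner incr_moments(1)) auto
      ultimately have "integrable M (\<lambda>\<omega>. Y \<omega> * incr (p m') (p (Suc m')) l \<omega>)"
        "expectation (\<lambda>\<omega>. Y \<omega> * incr (p m') (p (Suc m')) l \<omega>) = 0"
        by (rule past_times_incr[OF l])+
      moreover have "T a b = (\<lambda>\<omega>. Y \<omega> * incr (p m') (p (Suc m')) l \<omega>)"
        by (simp add: T_def Y_def a' b' fun_eq_iff mult_ac)
      ultimately show ?thesis using less by (simp add: a' b')
    qed
  qed
  have T_sym: "T a b = T b a" for a b
    by (simp add: T_def fun_eq_iff inner_commute mult.commute)
  have cross': "integrable M (T a b)" "expectation (T a b) = (if a = b then c a else 0)"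
    if "a \<in> A" "b \<in> A" for a b
    using cross[OF that] cross[OF that(2,1)] T_sym[of a b] by (cases "fst a \<le> fst b"; auto)+
  have "X \<omega> = (\<Sum>a\<in>A. incr (p (fst a)) (p (Suc (fst a))) (snd a) \<omega> *\<^sub>R \<theta> (fst a) (snd a) \<omega>)" for \<omega>
    unfolding X_def A_def by (simp add: sum.cartesian_product case_prod_beta)
  then have sq: "(norm (X \<omega>))\<^sup>2 = (\<Sum>a\<in>A. \<Sum>b\<in>A. T a b \<omega>)" for \<omega>
    unfolding power2_norm_eq_inner T_def
    by (simp add: inner_sum_left) (simp add: inner_sum_right sum_distrib_left mult.assoc)
  show "X \<in> borel_measurable M"
    unfolding X_def using \<xi> \<theta>M
    by (intro borel_measurable_sum borel_measurable_scaleR incr_measurable(2)) auto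
  show "integrable M (\<lambda>\<omega>. (norm (X \<omega>))\<^sup>2)"
    unfolding sq by (intro Bochner_Integration.integrable_sum cross')
  have "expectation (\<lambda>\<omega>. (norm (X \<omega>))\<^sup>2) = (\<Sum>a\<in>A. \<Sum>b\<in>A. expectation (T a b))"
    unfolding sq by (simp add: Bochner_Integration.integral_sum Bochner_Integration.integrable_sum cross')
  also have "\<dots> = (\<Sum>a\<in>A. \<Sum>b\<in>A. if a = b then c a else 0)"
    by (intro sum.cong refl cross')
  also have "\<dots> = (\<Sum>a\<in>A. c a)"
    using finA by simp
  also have "\<dots> = (\<Sum>m<n. \<Sum>k\<in>K. lam k * (p (Suc m) - p m) * expectation (\<lambda>\<omega>. (norm (\<theta> m k \<omega>))\<^sup>2))"
    by (simp add: A_def c_def sum.cartesian_product case_prod_beta)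
  finally show "expectation (\<lambda>\<omega>. (norm (X \<omega>))\<^sup>2) =
      (\<Sum>m<n. \<Sum>k\<in>K. lam k * (p (Suc m) - p m) * expectation (\<lambda>\<omega>. (norm (\<theta> m k \<omega>))\<^sup>2))" .
qed

end

section \<open>The second-moment bound, from elementary to general integrands\<close>

lemma ennreal_square_le_double_sum:
  fixes x y z :: real
  assumes "x \<le> y + z" "0 \<le> x" "0 \<le> y" "0 \<le> z"
  shows "ennreal (x\<^sup>2) \<le> 2 * ennreal (y\<^sup>2) + 2 * ennreal (z\<^sup>2)"
proof -
  have "x\<^sup>2 \<le> (y + z)\<^sup>2" using assms by (intro power_mono) auto
  also have "\<dots> \<le> 2 * y\<^sup>2 + 2 * z\<^sup>2"
    using sum_squares_bound[of y z] by (simp add: power2_sum)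
  finally have "ennreal (x\<^sup>2) \<le> ennreal (2 * y\<^sup>2 + 2 * z\<^sup>2)"
    by (rule ennreal_leI)
  then show ?thesis by (simp add: ennreal_mult)
qed

lemma predictable_process_space:
  assumes "normal_filtration M F" "predictable_process M F T N X" "t \<in> {0..T}" "\<omega> \<in> space M"
  shows "X t \<omega> \<in> space N"
  using measurable_space[OF predictable_process_restrict_space[OF assms(1) _ assms(2)], of "(t, \<omega>)"] assms(3,4)
  by (auto simp: space_restrict_space space_pair_measure)

text \<open>Extension by zero outside \<open>{0..T}\<close> gives joint measurability on the full
  product space, as Tonelli's theorem requires.\<close>

lemma predictable_process_indicator_measurable:
  fixes f :: "'e \<Rightarrow> 'b::real_normed_vector"
  assumes F: "normal_filtration M F" and T: "0 \<le> T" and X: "predictable_process M F T N X"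
    and f: "f \<in> borel_measurable N"
  shows "(\<lambda>(t, \<omega>). indicat_real {0..T} t *\<^sub>R f (X t \<omega>)) \<in> borel_measurable (lborel \<Otimes>\<^sub>M M)"
proof -
  let ?\<Omega> = "{0..T} \<times> space M"
  have "?\<Omega> \<inter> space (lborel \<Otimes>\<^sub>M M) \<in> sets (lborel \<Otimes>\<^sub>M M)" by simp
  moreover have "(\<lambda>x. f (case x of (t, \<omega>) \<Rightarrow> X t \<omega>)) \<in> borel_measurable (restrict_space (lborel \<Otimes>\<^sub>M M) ?\<Omega>)"
    by (rule measurable_compose[OF predictable_process_restrict_space[OF F T X] f])
  ultimately have "(\<lambda>x. indicat_real ?\<Omega> x *\<^sub>R f (case x of (t, \<omega>) \<Rightarrow> X t \<omega>)) \<in> borel_measurable (lborel \<Otimes>\<^sub>M M)"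
    by (simp add: borel_measurable_restrict_space_iff)
  then show ?thesis
    by (rule measurable_cong[THEN iffD1, rotated]) (auto simp: space_pair_measure indicator_def)
qed

lemma step_sum_unique:
  fixes c :: "nat \<Rightarrow> 'b::real_vector" and p :: "nat \<Rightarrow> real"
  assumes p: "\<And>m. m < n \<Longrightarrow> p m < p (Suc m)" and m: "m < n" "\<tau> \<in> {p m<..p (Suc m)}"
  shows "(\<Sum>j<n. indicat_real {p j<..p (Suc j)} \<tau> *\<^sub>R c j) = c m"
proof -
  note p_mono = partition_mono[where n=n and p=p, OF p]
  have "\<tau> \<notin> {p j<..p (Suc j)}" if "j < n" "j \<noteq> m" for j
    using p_mono[of "Suc j" m] p_mono[of "Suc m" j] m that by (cases "j < m") auto
  then have "(\<Sum>j<n. indicat_real {p j<..p (Suc j)} \<tau> *\<^sub>R c j) = (\<Sum>j<n. if j = m then c m else 0)"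
    using m by (intro sum.cong refl) auto
  then show ?thesis using m by simp
qed

context cylindrical_noise
begin

lemma elementary_data_D:
  assumes "elementary_data M F Q I e t n p \<Theta>"
  shows "p 0 = 0" "p n = t" "\<And>m. m < n \<Longrightarrow> p m < p (Suc m)"
    "\<And>m. m < n \<Longrightarrow> finite (\<Theta> m ` space M)"
    "\<And>m \<omega>. m < n \<Longrightarrow> \<omega> \<in> space M \<Longrightarrow> \<Theta> m \<omega> \<in> L20 Q"
    "\<And>m \<omega>. m < n \<Longrightarrow> \<omega> \<in> space M \<Longrightarrow> finite {k\<in>I. e k \<in> U0 Q \<and> \<Theta> m \<omega> (e k) \<noteq> 0}"
    "\<And>m B. m < n \<Longrightarrow> {\<omega>\<in>space M. \<Theta> m \<omega> = B} \<in> sets (F (p m))"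
proof -
  note D = assms[unfolded elementary_data_def]
  note D1 = D[THEN conjunct2, THEN conjunct2, THEN conjunct1, rule_format]
    and D2 = D[THEN conjunct2, THEN conjunct2, THEN conjunct2, THEN spec, THEN mp]
  show "p 0 = 0" "p n = t" using D by simp_all
  show "\<And>m. m < n \<Longrightarrow> p m < p (Suc m)" by (rule D1)
  show "finite (\<Theta> m ` space M)" if "m < n" for m
    using D2[OF that] by (rule conjunct1)
  show "\<Theta> m \<omega> \<in> L20 Q" "finite {k\<in>I. e k \<in> U0 Q \<and> \<Theta> m \<omega> (e k) \<noteq> 0}"
    if "m < n" "\<omega> \<in> space M" for m \<omega>
    using D2[OF that(1), THEN conjunct2, THEN conjunct1, THEN bspec, OF that(2)] by simp_all
  show "{\<omega>\<in>space M. \<Theta> m \<omega> = B} \<in> sets (F (p m))" if "m < n" for m B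
    using D2[OF that, THEN conjunct2, THEN conjunct2] by (rule spec)
qed

text \<open>\<open>K\<close> may exceed the support of \<open>B\<close>, so that one finite set can
  serve all values of an elementary process.\<close>

lemma L20_norm_sq_coordinates:
  fixes B :: "'u \<Rightarrow> 'h::real_inner"
  assumes B: "B \<in> L20 Q" and K: "finite K" "K \<subseteq> {k\<in>I. e k \<in> U0 Q}"
    "{k\<in>I. e k \<in> U0 Q \<and> B (e k) \<noteq> 0} \<subseteq> K"
  shows "(\<Sum>k\<in>K. lam k * (norm (B (e k)))\<^sup>2) = (L20_norm Q B)\<^sup>2"
proof -
  let ?S = "{k\<in>I. e k \<in> U0 Q \<and> B (e k) \<noteq> 0}"
  have S: "finite ?S" by (rule finite_subset[OF K(3,1)])
  have im: "{g \<in> e ` I \<inter> U0 Q. B g \<noteq> 0} = e ` ?S" by auto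
  have inj: "inj_on e ?S" using inj_e by (rule inj_on_subset) auto
  have "(L20_norm Q B)\<^sup>2 = (\<Sum>g\<in>e ` ?S. (blinfun_apply Q g \<bullet> g) * (norm (B g))\<^sup>2)"
    using dop.L20_norm_sq_finite_support[OF B] S unfolding im by simp
  also have "\<dots> = (\<Sum>k\<in>?S. lam k * (norm (B (e k)))\<^sup>2)"
    using inj by (simp add: sum.reindex lam_eq)
  also have "\<dots> = (\<Sum>k\<in>K. lam k * (norm (B (e k)))\<^sup>2)"
    using K by (intro sum.mono_neutral_left) auto
  finally show ?thesis ..
qed

text \<open>With finitely many values and measurable level sets, \<open>\<Theta> m\<close> is
  measurable into a discrete space, from which every \<open>f\<close> is measurable.\<close>

lemma elementary_value_measurable:
  fixes f :: "('u \<Rightarrow> 'h::real_normed_vector) \<Rightarrow> 'b::topological_space"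
  assumes D: "elementary_data M F Q I e t n p \<Theta>" and m: "m < n" and p: "0 \<le> p m"
  shows "(\<lambda>\<omega>. f (\<Theta> m \<omega>)) \<in> borel_measurable (F (p m))"
proof -
  have sp: "space (F (p m)) = space M"
    using normal_filtration_D(1)[OF F p] by (simp add: subalgebra_def)
  have "\<Theta> m -` {B} \<inter> space M \<in> sets (F (p m))" for B
    using elementary_data_D(7)[OF D m, of B] by (simp add: vimage_def Int_def conj_commute)
  then have "\<Theta> m \<in> F (p m) \<rightarrow>\<^sub>M count_space (\<Theta> m ` space M)"
    using elementary_data_D(4)[OF D m] by (simp add: measurable_count_space_eq2 sp)
  then show ?thesis
    by (rule measurable_compose) simp
qed

lemma elementary_isometry:
  fixes \<Theta> :: "nat \<Rightarrow> 'w \<Rightarrow> 'u \<Rightarrow> 'h::{real_inner, second_countable_topology}"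
  assumes D: "elementary_data M F Q I e t n p \<Theta>"
  shows "elementary_integral Q I e \<beta> n p \<Theta> \<in> borel_measurable M"
    "(\<integral>\<^sup>+\<omega>. ennreal ((norm (elementary_integral Q I e \<beta> n p \<Theta> \<omega>))\<^sup>2) \<partial>M) =
      (\<Sum>m<n. \<integral>\<^sup>+\<omega>. ennreal ((p (Suc m) - p m) * (L20_norm Q (\<Theta> m \<omega>))\<^sup>2) \<partial>M)"
proof -
  note D' = elementary_data_D[OF D]
  have p_nonneg: "0 \<le> p m" if "m \<le> n" for m
    using that
  proof (induction m)
    case (Suc m)
    then show ?case using D'(3)[of m] by simp
  qed (simp add: D'(1))
  define supp where "supp B = {k\<in>I. e k \<in> U0 Q \<and> B (e k) \<noteq> 0}" for B :: "'u \<Rightarrow> 'h"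
  \<comment> \<open>The inner index set of \<open>elementary_integral\<close> depends on \<omega>.
    The union of the supports of the finitely many values is a fixed finite set, and the added terms
    are zero.\<close>
  define K where "K = (\<Union>m<n. \<Union>B\<in>\<Theta> m ` space M. supp B)"
  define \<theta> where "\<theta> m k \<omega> = \<Theta> m \<omega> (e k)" for m k \<omega>
  have "finite (\<Union>B\<in>\<Theta> m ` space M. supp B)" if "m < n" for m
    by (rule finite_UN_I[OF D'(4)[OF that]]) (use that D'(6) in \<open>auto simp: supp_def\<close>)
  then have "finite K"
    unfolding K_def by (rule finite_UN_I[OF finite_lessThan]) simp
  moreover have "K \<subseteq> {k\<in>I. e k \<in> U0 Q}" "K \<subseteq> I"
    by (auto simp: K_def supp_def)
  ultimately have K: "finite K" "K \<subseteq> {k\<in>I. e k \<in> U0 Q}" "K \<subseteq> I" by blast+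
  have suppK: "supp (\<Theta> m \<omega>) \<subseteq> K" if "m < n" "\<omega> \<in> space M" for m \<omega>
    using that by (auto simp: K_def)
  have \<theta>: "\<theta> m k \<in> borel_measurable (F (p m))" if "m < n" for m k
    unfolding \<theta>_def using that p_nonneg[of m]
    by (intro elementary_value_measurable[OF D, where f="\<lambda>B. B (e k)"]) auto
  have bd: "\<exists>C. \<forall>\<omega>\<in>space M. norm (\<theta> m k \<omega>) \<le> C" if "m < n" for m k
  proof -
    have "bounded ((\<lambda>B. B (e k)) ` \<Theta> m ` space M)"
      by (rule finite_imp_bounded[OF finite_imageI[OF D'(4)[OF that]]])
    then show ?thesis by (auto simp: bounded_iff \<theta>_def)
  qed
  define X where "X \<omega> = (\<Sum>m<n. \<Sum>k\<in>K. incr (p m) (p (Suc m)) k \<omega> *\<^sub>R \<theta> m k \<omega>)" for \<omega>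
  have eq: "elementary_integral Q I e \<beta> n p \<Theta> \<omega> = X \<omega>" if "\<omega> \<in> space M" for \<omega>
    unfolding elementary_integral_def X_def
  proof (rule sum.cong[OF refl])
    fix m assume "m \<in> {..<n}"
    then have "supp (\<Theta> m \<omega>) \<subseteq> K" using suppK that by simp
    then show "(\<Sum>k\<in>{k\<in>I. e k \<in> U0 Q \<and> \<Theta> m \<omega> (e k) \<noteq> 0}.
        (\<beta> k (p (Suc m)) \<omega> - \<beta> k (p m) \<omega>) *\<^sub>R \<Theta> m \<omega> (e k)) =
        (\<Sum>k\<in>K. incr (p m) (p (Suc m)) k \<omega> *\<^sub>R \<theta> m k \<omega>)"
      using K unfolding supp_def incr_def \<theta>_def by (intro sum.mono_neutral_left) auto
  qed
  have "0 \<le> p 0" using D'(1) by simp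
  note ito = ito_isometry_finite[where n=n and \<theta>=\<theta>, OF K(1,3) this D'(3), folded X_def,
      OF _ \<theta> bd, simplified]
  show "elementary_integral Q I e \<beta> n p \<Theta> \<in> borel_measurable M"
    using ito(1) by (subst measurable_cong[OF eq])
  have sq_int: "integrable M (\<lambda>\<omega>. (norm (\<theta> m k \<omega>))\<^sup>2)" if m: "m < n" for m k
  proof -
    obtain C where C: "\<And>\<omega>. \<omega> \<in> space M \<Longrightarrow> norm (\<theta> m k \<omega>) \<le> C" using bd[OF m] by blast
    have "\<theta> m k \<in> borel_measurable M"
      using filtration_measurable(1)[OF F _ \<theta>[OF m]] p_nonneg[of m] m by simp
    then show ?thesis
      using C by (intro integrable_const_bound[where B="C\<^sup>2"] AE_I2) (auto intro: power_mono)
  qed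
  \<comment> \<open>The variances \<open>lam k\<close> are the weights that turn the sum over
    coordinates into the squared norm of \<open>\<Theta> m \<omega>\<close>.\<close>
  have eqm: "(\<Sum>k\<in>K. lam k * (p (Suc m) - p m) * expectation (\<lambda>\<omega>. (norm (\<theta> m k \<omega>))\<^sup>2)) =
      expectation (\<lambda>\<omega>. (p (Suc m) - p m) * (L20_norm Q (\<Theta> m \<omega>))\<^sup>2) \<and>
      integrable M (\<lambda>\<omega>. (p (Suc m) - p m) * (L20_norm Q (\<Theta> m \<omega>))\<^sup>2)" if m: "m < n" for m
  proof -
    have e1: "(\<Sum>k\<in>K. lam k * (p (Suc m) - p m) * expectation (\<lambda>\<omega>. (norm (\<theta> m k \<omega>))\<^sup>2)) =
        expectation (\<lambda>\<omega>. \<Sum>k\<in>K. lam k * (p (Suc m) - p m) * (norm (\<theta> m k \<omega>))\<^sup>2)"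
      using sq_int[OF m] by (simp add: Bochner_Integration.integral_sum)
    have eq': "(\<Sum>k\<in>K. lam k * (p (Suc m) - p m) * (norm (\<theta> m k \<omega>))\<^sup>2) =
        (p (Suc m) - p m) * (L20_norm Q (\<Theta> m \<omega>))\<^sup>2" if "\<omega> \<in> space M" for \<omega>
      unfolding \<theta>_def
        L20_norm_sq_coordinates[OF D'(5)[OF m that] K(1,2) suppK[OF m that, unfolded supp_def], symmetric]
      by (simp add: sum_distrib_left mult_ac)
    have int: "integrable M (\<lambda>\<omega>. \<Sum>k\<in>K. lam k * (p (Suc m) - p m) * (norm (\<theta> m k \<omega>))\<^sup>2)"
      using sq_int[OF m] by simp
    show ?thesis
      by (rule conjI[OF trans[OF e1 Bochner_Integration.integral_cong[OF refl eq']]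
            Bochner_Integration.integrable_cong[OF refl eq', THEN iffD1, OF _ int]])
  qed
  have "(\<integral>\<^sup>+\<omega>. ennreal ((norm (elementary_integral Q I e \<beta> n p \<Theta> \<omega>))\<^sup>2) \<partial>M) =
      (\<integral>\<^sup>+\<omega>. ennreal ((norm (X \<omega>))\<^sup>2) \<partial>M)"
    by (intro nn_integral_cong) (simp add: eq)
  also have "\<dots> = ennreal (\<Sum>m<n. expectation (\<lambda>\<omega>. (p (Suc m) - p m) * (L20_norm Q (\<Theta> m \<omega>))\<^sup>2))"
    using ito(2,3) eqm by (simp add: nn_integral_eq_integral)
  also have "\<dots> = (\<Sum>m<n. ennreal (expectation (\<lambda>\<omega>. (p (Suc m) - p m) * (L20_norm Q (\<Theta> m \<omega>))\<^sup>2)))"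
    using D'(3) by (intro sum_ennreal[symmetric] integral_nonneg_AE AE_I2) (auto simp: less_imp_le)
  also have "\<dots> = (\<Sum>m<n. \<integral>\<^sup>+\<omega>. ennreal ((p (Suc m) - p m) * (L20_norm Q (\<Theta> m \<omega>))\<^sup>2) \<partial>M)"
    using D'(3) eqm
    by (intro sum.cong refl nn_integral_eq_integral[symmetric] AE_I2) (auto simp: less_imp_le)
  finally show "(\<integral>\<^sup>+\<omega>. ennreal ((norm (elementary_integral Q I e \<beta> n p \<Theta> \<omega>))\<^sup>2) \<partial>M) =
      (\<Sum>m<n. \<integral>\<^sup>+\<omega>. ennreal ((p (Suc m) - p m) * (L20_norm Q (\<Theta> m \<omega>))\<^sup>2) \<partial>M)" .
qed

text \<open>The intervals are disjoint, so at most one term is nonzero. Where none is, in particular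
  at time 0, the value is the zero operator.\<close>

lemma elementary_process_value:
  fixes \<Theta> :: "nat \<Rightarrow> 'w \<Rightarrow> 'u \<Rightarrow> 'h::real_normed_vector"
  assumes D: "elementary_data M F Q I e t n p \<Theta>" and \<omega>: "\<omega> \<in> space M"
  shows "elementary_process Q n p \<Theta> \<tau> \<omega> \<in> L20 Q"
    "L20_norm Q (elementary_process Q n p \<Theta> \<tau> \<omega>) =
      (\<Sum>m<n. indicat_real {p m<..p (Suc m)} \<tau> *\<^sub>R L20_norm Q (\<Theta> m \<omega>))"
proof -
  have "elementary_process Q n p \<Theta> \<tau> \<omega> \<in> L20 Q \<and> L20_norm Q (elementary_process Q n p \<Theta> \<tau> \<omega>) =
      (\<Sum>m<n. indicat_real {p m<..p (Suc m)} \<tau> *\<^sub>R L20_norm Q (\<Theta> m \<omega>))"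
  proof (cases "\<exists>m<n. \<tau> \<in> {p m<..p (Suc m)}")
    case True
    then obtain m where m: "m < n" "\<tau> \<in> {p m<..p (Suc m)}" by blast
    note step = step_sum_unique[OF elementary_data_D(3)[OF D] m]
    have "\<Theta> m \<omega> \<in> L20 Q" by (rule elementary_data_D(5)[OF D m(1) \<omega>])
    moreover have "elementary_process Q n p \<Theta> \<tau> \<omega> = \<Theta> m \<omega>"
    proof (rule extensionalityI)
      show "elementary_process Q n p \<Theta> \<tau> \<omega> \<in> extensional (U0 Q)"
        by (simp add: elementary_process_def)
      show "\<Theta> m \<omega> \<in> extensional (U0 Q)"
        by (rule dop.L20_D(1)) fact
      show "elementary_process Q n p \<Theta> \<tau> \<omega> u = \<Theta> m \<omega> u" if "u \<in> U0 Q" for u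
        using that by (simp only: elementary_process_def restrict_apply if_True step)
    qed
    ultimately show ?thesis by (simp only: step)
  next
    case False
    then have 0: "indicat_real {p m<..p (Suc m)} \<tau> = 0" if "m < n" for m
      using that by (auto simp: indicator_def)
    then have "elementary_process Q n p \<Theta> \<tau> \<omega> = (\<lambda>u\<in>U0 Q. 0)"
      by (simp add: elementary_process_def fun_eq_iff restrict_def)
    moreover have "L20_norm Q (\<lambda>u\<in>U0 Q. 0 :: 'h) = 0"
      using dop.L20_norm_cong[of "\<lambda>u\<in>U0 Q. 0" "\<lambda>_. 0 :: 'h"] by (simp add: L20_norm_def hs_norm_def)
    ultimately show ?thesis
      using 0 dop.zero_L20 by simp
  qed
  then show "elementary_process Q n p \<Theta> \<tau> \<omega> \<in> L20 Q"
    "L20_norm Q (elementary_process Q n p \<Theta> \<tau> \<omega>) =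
      (\<Sum>m<n. indicat_real {p m<..p (Suc m)} \<tau> *\<^sub>R L20_norm Q (\<Theta> m \<omega>))" by blast+
qed

text \<open>The isometry as an integral over time and chance. Here \<open>a\<close> is the norm of
  the elementary process, written as a real step function whose joint measurability is
  evident.\<close>

lemma elementary_isometry_time:
  fixes \<Theta> :: "nat \<Rightarrow> 'w \<Rightarrow> 'u \<Rightarrow> 'h::{real_inner, second_countable_topology}"
  assumes D: "elementary_data M F Q I e t n p \<Theta>"
  defines "a \<equiv> \<lambda>\<tau> \<omega>. \<Sum>m<n. indicat_real {p m<..p (Suc m)} \<tau> *\<^sub>R L20_norm Q (\<Theta> m \<omega>)"
  shows "(\<lambda>(\<tau>, \<omega>). a \<tau> \<omega>) \<in> borel_measurable (lborel \<Otimes>\<^sub>M M)"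
    "\<And>\<tau> \<omega>. \<tau> \<notin> {0..t} \<Longrightarrow> a \<tau> \<omega> = 0"
    "(\<integral>\<^sup>+\<omega>. ennreal ((norm (elementary_integral Q I e \<beta> n p \<Theta> \<omega>))\<^sup>2) \<partial>M) =
      (\<integral>\<^sup>+\<omega>. \<integral>\<^sup>+\<tau>. ennreal ((a \<tau> \<omega>)\<^sup>2) \<partial>lborel \<partial>M)"
proof -
  note D' = elementary_data_D[OF D]
  note p_mono = partition_mono[where n=n and p=p, OF D'(3)]
  have meas: "(\<lambda>\<omega>. L20_norm Q (\<Theta> m \<omega>)) \<in> borel_measurable M" if "m < n" for m
    using p_mono[of 0 m] D'(1) that
    by (intro filtration_measurable(1)[OF F _ elementary_value_measurable[OF D that]]) auto
  show "(\<lambda>(\<tau>, \<omega>). a \<tau> \<omega>) \<in> borel_measurable (lborel \<Otimes>\<^sub>M M)"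
  proof -
    have [measurable]: "(\<lambda>x. L20_norm Q (\<Theta> m (snd x))) \<in> borel_measurable (lborel \<Otimes>\<^sub>M M)" if "m < n" for m
      by (rule measurable_compose[OF measurable_snd meas[OF that]])
    have "(\<lambda>x. indicat_real {p m<..p (Suc m)} (fst x)) \<in> borel_measurable (lborel \<Otimes>\<^sub>M M)" for m
      by measurable
    then show ?thesis
      unfolding a_def case_prod_beta
      by (intro borel_measurable_sum borel_measurable_scaleR) auto
  qed
  show "a \<tau> \<omega> = 0" if "\<tau> \<notin> {0..t}" for \<tau> \<omega>
    unfolding a_def
  proof (rule sum.neutral, rule ballI)
    fix m assume "m \<in> {..<n}"
    then have "0 \<le> p m" "p (Suc m) \<le> t"
      using p_mono[of 0 m] p_mono[of "Suc m" n] D'(1,2) by auto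
    then have "\<tau> \<notin> {p m<..p (Suc m)}" using that by auto
    then show "indicat_real {p m<..p (Suc m)} \<tau> *\<^sub>R L20_norm Q (\<Theta> m \<omega>) = 0" by simp
  qed
  \<comment> \<open>Squaring passes through the step sum because at most one indicator is
    nonzero.\<close>
  have sq: "(a \<tau> \<omega>)\<^sup>2 = (\<Sum>m<n. indicat_real {p m<..p (Suc m)} \<tau> *\<^sub>R (L20_norm Q (\<Theta> m \<omega>))\<^sup>2)" for \<tau> \<omega>
  proof (cases "\<exists>m<n. \<tau> \<in> {p m<..p (Suc m)}")
    case True
    then obtain m where "m < n" "\<tau> \<in> {p m<..p (Suc m)}" by blast
    note step = step_sum_unique[OF D'(3) this]
    show ?thesis by (simp only: a_def step)
  next
    case False
    then have "indicat_real {p m<..p (Suc m)} \<tau> *\<^sub>R c m = 0" if "m < n" for m and c :: "nat \<Rightarrow> real"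
      using that by (auto simp: indicator_def)
    then have "(\<Sum>m<n. indicat_real {p m<..p (Suc m)} \<tau> *\<^sub>R c m) = 0" for c :: "nat \<Rightarrow> real"
      by (intro sum.neutral) blast
    then show ?thesis by (simp only: a_def zero_power2)
  qed
  have time: "(\<integral>\<^sup>+\<tau>. ennreal ((a \<tau> \<omega>)\<^sup>2) \<partial>lborel) =
      (\<Sum>m<n. ennreal ((p (Suc m) - p m) * (L20_norm Q (\<Theta> m \<omega>))\<^sup>2))" for \<omega>
  proof -
    have "(\<integral>\<^sup>+\<tau>. ennreal ((a \<tau> \<omega>)\<^sup>2) \<partial>lborel) =
        (\<integral>\<^sup>+\<tau>. (\<Sum>m<n. ennreal ((L20_norm Q (\<Theta> m \<omega>))\<^sup>2) * indicator {p m<..p (Suc m)} \<tau>) \<partial>lborel)"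
      unfolding sq
      by (intro nn_integral_cong) (auto simp flip: sum_ennreal simp: indicator_def intro!: sum.cong)
    also have "\<dots> = (\<Sum>m<n. ennreal ((L20_norm Q (\<Theta> m \<omega>))\<^sup>2) * emeasure lborel {p m<..p (Suc m)})"
      by (subst nn_integral_sum) (simp_all add: nn_integral_cmult_indicator)
    also have "\<dots> = (\<Sum>m<n. ennreal ((p (Suc m) - p m) * (L20_norm Q (\<Theta> m \<omega>))\<^sup>2))"
      using D'(3) by (intro sum.cong refl) (simp add: less_imp_le ennreal_mult mult.commute)
    finally show ?thesis .
  qed
  show "(\<integral>\<^sup>+\<omega>. ennreal ((norm (elementary_integral Q I e \<beta> n p \<Theta> \<omega>))\<^sup>2) \<partial>M) =
      (\<integral>\<^sup>+\<omega>. \<integral>\<^sup>+\<tau>. ennreal ((a \<tau> \<omega>)\<^sup>2) \<partial>lborel \<partial>M)"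
    unfolding time elementary_isometry(2)[OF D]
    using meas by (subst nn_integral_sum) auto
qed

text \<open>The constant 4 is the product of two factors 2 from
  \<open>ennreal_square_le_double_sum\<close>: one for comparing \<open>X\<close> with an elementary
  integral, one for comparing the elementary integrand with \<open>\<Phi>\<close>. Both error terms
  vanish in the limit.\<close>

lemma has_stoch_integral_bound:
  fixes \<Phi> :: "real \<Rightarrow> 'w \<Rightarrow> 'u \<Rightarrow> 'h::{real_inner, banach, second_countable_topology}"
  assumes H: "has_stoch_integral M F Q I e \<beta> t \<Phi> X" and t: "0 \<le> t"
  shows "(\<integral>\<^sup>+\<omega>. ennreal ((norm (X \<omega>))\<^sup>2) \<partial>M) \<le>
    4 * (\<integral>\<^sup>+\<omega>. (\<integral>\<^sup>+\<tau>\<in>{0..t}. ennreal ((L20_norm Q (\<Phi> \<tau> \<omega>))\<^sup>2) \<partial>lborel) \<partial>M)"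
proof -
  note H' = H[unfolded has_stoch_integral_def]
  have \<Phi>: "predictable_process M F t (L20_borel Q) \<Phi>"
    using H' by (simp add: N2_def)
  have X: "X \<in> borel_measurable M" using H' by simp
  obtain n p \<Theta> where data: "\<And>j. elementary_data M F Q I e t (n j) (p j) (\<Theta> j)"
    and lim_data: "(\<lambda>j. \<integral>\<^sup>+\<omega>. (\<integral>\<^sup>+\<tau>\<in>{0..t}. ennreal ((L20_norm Q
              (\<lambda>u. elementary_process Q (n j) (p j) (\<Theta> j) \<tau> \<omega> u - \<Phi> \<tau> \<omega> u))\<^sup>2) \<partial>lborel) \<partial>M)
          \<longlonglongrightarrow> 0"
    and lim: "(\<lambda>j. \<integral>\<^sup>+\<omega>. ennreal ((norm (elementary_integral Q I e \<beta> (n j) (p j) (\<Theta> j) \<omega> - X \<omega>))\<^sup>2) \<partial>M)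
          \<longlonglongrightarrow> 0"
    using H' by blast
  define D where "D j = (\<integral>\<^sup>+\<omega>. (\<integral>\<^sup>+\<tau>\<in>{0..t}. ennreal ((L20_norm Q
              (\<lambda>u. elementary_process Q (n j) (p j) (\<Theta> j) \<tau> \<omega> u - \<Phi> \<tau> \<omega> u))\<^sup>2) \<partial>lborel) \<partial>M)" for j
  define J where "J j = elementary_integral Q I e \<beta> (n j) (p j) (\<Theta> j)" for j
  define b where "b \<tau> \<omega> = indicat_real {0..t} \<tau> *\<^sub>R L20_norm Q (\<Phi> \<tau> \<omega>)" for \<tau> \<omega>
  define N where "N = (\<integral>\<^sup>+\<omega>. \<integral>\<^sup>+\<tau>. ennreal ((b \<tau> \<omega>)\<^sup>2) \<partial>lborel \<partial>M)"
  have b_meas[measurable]: "(\<lambda>(\<tau>, \<omega>). b \<tau> \<omega>) \<in> borel_measurable (lborel \<Otimes>\<^sub>M M)"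
    unfolding b_def
    by (rule predictable_process_indicator_measurable[OF F t \<Phi> dop.L20_norm_measurable])
  have N_eq: "(\<integral>\<^sup>+\<omega>. (\<integral>\<^sup>+\<tau>\<in>{0..t}. ennreal ((L20_norm Q (\<Phi> \<tau> \<omega>))\<^sup>2) \<partial>lborel) \<partial>M) = N"
    unfolding N_def by (intro nn_integral_cong) (simp add: b_def indicator_def)
  have b_nonneg: "0 \<le> b \<tau> \<omega>" for \<tau> \<omega>
    by (simp add: b_def dop.L20_norm_nonneg)
  have bound: "(\<integral>\<^sup>+\<omega>. ennreal ((norm (J j \<omega>))\<^sup>2) \<partial>M) \<le> 2 * D j + 2 * N" for j
  proof -
    define a where "a \<tau> \<omega> = (\<Sum>m<n j. indicat_real {p j m<..p j (Suc m)} \<tau> *\<^sub>R L20_norm Q (\<Theta> j m \<omega>))" for \<tau> \<omega>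
    note iso = elementary_isometry_time[OF data[of j], folded a_def]
    have a_meas[measurable]: "(\<lambda>(\<tau>, \<omega>). a \<tau> \<omega>) \<in> borel_measurable (lborel \<Otimes>\<^sub>M M)" by (rule iso(1))
    have a_nonneg: "0 \<le> a \<tau> \<omega>" for \<tau> \<omega>
      unfolding a_def by (intro sum_nonneg) (simp add: dop.L20_norm_nonneg)
    text \<open>The integrand of \<open>D j\<close> is not known to be measurable. The truncated difference
      \<open>max 0 (a - b)\<close> is, and it lies below it.\<close>
    define h where "h \<tau> \<omega> = max 0 (a \<tau> \<omega> - b \<tau> \<omega>)" for \<tau> \<omega>
    have h_meas[measurable]: "(\<lambda>(\<tau>, \<omega>). h \<tau> \<omega>) \<in> borel_measurable (lborel \<Otimes>\<^sub>M M)"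
      unfolding h_def using a_meas b_meas by (simp add: case_prod_beta)
    have hD: "ennreal ((h \<tau> \<omega>)\<^sup>2) \<le> ennreal ((L20_norm Q
        (\<lambda>u. elementary_process Q (n j) (p j) (\<Theta> j) \<tau> \<omega> u - \<Phi> \<tau> \<omega> u))\<^sup>2) * indicator {0..t} \<tau>"
      if \<omega>: "\<omega> \<in> space M" for \<tau> \<omega>
    proof (cases "\<tau> \<in> {0..t}")
      case True
      let ?E = "elementary_process Q (n j) (p j) (\<Theta> j) \<tau> \<omega>"
      have E: "?E \<in> L20 Q" by (rule elementary_process_value(1)[OF data \<omega>])
      have P: "\<Phi> \<tau> \<omega> \<in> L20 Q"
        using predictable_process_space[OF F \<Phi> True \<omega>] by (simp add: dop.L20_borel_space)
      have "a \<tau> \<omega> = L20_norm Q (\<lambda>u. (?E u - \<Phi> \<tau> \<omega> u) + \<Phi> \<tau> \<omega> u)"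
        using elementary_process_value(2)[OF data \<omega>, of j \<tau>] by (simp add: a_def)
      also have "\<dots> \<le> L20_norm Q (\<lambda>u. ?E u - \<Phi> \<tau> \<omega> u) + L20_norm Q (\<Phi> \<tau> \<omega>)"
        by (rule dop.L20_triangle(2)[OF dop.L20_diff_summable[OF E P] dop.L20_D(4)[OF P]])
      finally have "h \<tau> \<omega> \<le> L20_norm Q (\<lambda>u. ?E u - \<Phi> \<tau> \<omega> u)"
        using True dop.L20_norm_nonneg by (simp add: h_def b_def)
      then have "(h \<tau> \<omega>)\<^sup>2 \<le> (L20_norm Q (\<lambda>u. ?E u - \<Phi> \<tau> \<omega> u))\<^sup>2"
        by (intro power_mono) (simp_all add: h_def)
      then show ?thesis using True by (simp add: ennreal_leI)
    next
      case False
      then show ?thesis using iso(2)[of \<tau> \<omega>] b_nonneg[of \<tau> \<omega>] by (simp add: h_def)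
    qed
    \<comment> \<open>\<open>a \<le> h + b\<close> holds whichever of \<open>a\<close> and
      \<open>b\<close> is larger, so the truncation does no harm.\<close>
    have ab: "ennreal ((a \<tau> \<omega>)\<^sup>2) \<le> 2 * ennreal ((h \<tau> \<omega>)\<^sup>2) + 2 * ennreal ((b \<tau> \<omega>)\<^sup>2)" for \<tau> \<omega>
      using a_nonneg b_nonneg by (intro ennreal_square_le_double_sum) (simp_all add: h_def)
    have "(\<integral>\<^sup>+\<omega>. ennreal ((norm (J j \<omega>))\<^sup>2) \<partial>M) = (\<integral>\<^sup>+\<omega>. \<integral>\<^sup>+\<tau>. ennreal ((a \<tau> \<omega>)\<^sup>2) \<partial>lborel \<partial>M)"
      unfolding J_def by (rule iso(3))
    also have "\<dots> \<le> (\<integral>\<^sup>+\<omega>. \<integral>\<^sup>+\<tau>. 2 * ennreal ((h \<tau> \<omega>)\<^sup>2) + 2 * ennreal ((b \<tau> \<omega>)\<^sup>2) \<partial>lborel \<partial>M)"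
      by (intro nn_integral_mono ab)
    also have "\<dots> = (\<integral>\<^sup>+\<omega>. 2 * (\<integral>\<^sup>+\<tau>. ennreal ((h \<tau> \<omega>)\<^sup>2) \<partial>lborel) + 2 * (\<integral>\<^sup>+\<tau>. ennreal ((b \<tau> \<omega>)\<^sup>2) \<partial>lborel) \<partial>M)"
      by (intro nn_integral_cong) (simp add: nn_integral_add nn_integral_cmult)
    also have "\<dots> = 2 * (\<integral>\<^sup>+\<omega>. \<integral>\<^sup>+\<tau>. ennreal ((h \<tau> \<omega>)\<^sup>2) \<partial>lborel \<partial>M) + 2 * N"
      unfolding N_def by (simp add: nn_integral_add nn_integral_cmult)
    also have "(\<integral>\<^sup>+\<omega>. \<integral>\<^sup>+\<tau>. ennreal ((h \<tau> \<omega>)\<^sup>2) \<partial>lborel \<partial>M) \<le> D j"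
      unfolding D_def by (intro nn_integral_mono hD)
    finally show ?thesis by (simp add: mult_left_mono add_right_mono)
  qed
  have J_meas[measurable]: "J j \<in> borel_measurable M" for j
    unfolding J_def by (rule elementary_isometry(1)[OF data])
  have le: "(\<integral>\<^sup>+\<omega>. ennreal ((norm (X \<omega>))\<^sup>2) \<partial>M) \<le>
      2 * (\<integral>\<^sup>+\<omega>. ennreal ((norm (J j \<omega> - X \<omega>))\<^sup>2) \<partial>M) + (4 * D j + 4 * N)" for j
  proof -
    have "ennreal ((norm (X \<omega>))\<^sup>2) \<le>
        2 * ennreal ((norm (J j \<omega> - X \<omega>))\<^sup>2) + 2 * ennreal ((norm (J j \<omega>))\<^sup>2)" for \<omega>
      using norm_triangle_ineq2[of "X \<omega>" "J j \<omega>"]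
      by (intro ennreal_square_le_double_sum) (simp_all add: norm_minus_commute)
    then have "(\<integral>\<^sup>+\<omega>. ennreal ((norm (X \<omega>))\<^sup>2) \<partial>M) \<le>
        (\<integral>\<^sup>+\<omega>. 2 * ennreal ((norm (J j \<omega> - X \<omega>))\<^sup>2) + 2 * ennreal ((norm (J j \<omega>))\<^sup>2) \<partial>M)"
      by (intro nn_integral_mono)
    also have "\<dots> = 2 * (\<integral>\<^sup>+\<omega>. ennreal ((norm (J j \<omega> - X \<omega>))\<^sup>2) \<partial>M) +
        2 * (\<integral>\<^sup>+\<omega>. ennreal ((norm (J j \<omega>))\<^sup>2) \<partial>M)"
      using X by (simp add: nn_integral_add nn_integral_cmult)
    also have "\<dots> \<le> 2 * (\<integral>\<^sup>+\<omega>. ennreal ((norm (J j \<omega> - X \<omega>))\<^sup>2) \<partial>M) + 2 * (2 * D j + 2 * N)"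
      by (intro add_left_mono mult_left_mono bound) simp
    finally show ?thesis
      by (simp add: distrib_left mult.assoc[symmetric])
  qed
  have "(\<lambda>j. 2 * (\<integral>\<^sup>+\<omega>. ennreal ((norm (J j \<omega> - X \<omega>))\<^sup>2) \<partial>M) + (4 * D j + 4 * N))
      \<longlonglongrightarrow> 2 * 0 + (4 * 0 + 4 * N)"
    using lim lim_data unfolding J_def D_def
    by (intro tendsto_add tendsto_const ennreal_tendsto_cmult) auto
  then have "(\<integral>\<^sup>+\<omega>. ennreal ((norm (X \<omega>))\<^sup>2) \<partial>M) \<le> 2 * 0 + (4 * 0 + 4 * N)"
    by (rule LIMSEQ_le_const) (use le in blast)
  then show ?thesis by (simp add: N_eq)
qed

end

section \<open>Square integrability of the trajectories\<close>

text \<open>For \<tau> in \<open>{0..t}\<close> the argument \<open>t - \<tau>\<close> stays in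
  \<open>{0..T}\<close>, where \<open>c\<close> bounds the resolvent. Enlarging the time interval to
  \<open>{0..T}\<close> makes the bound uniform in \<open>t\<close>.\<close>

lemma (in cylindrical_noise) stoch_convolution_bound:
  fixes S :: "real \<Rightarrow> ('h::{real_inner, banach, second_countable_topology} \<Rightarrow>\<^sub>L 'h)"
  assumes \<Psi>: "\<Psi> \<in> N2 M F Q T" and S: "\<And>t. t \<in> {0..T} \<Longrightarrow> norm (S t) \<le> c" and t: "t \<in> {0..T}"
    and ex: "\<exists>X. has_stoch_integral M F Q I e \<beta> t
        (\<lambda>\<tau> \<omega>. compose (U0 Q) (blinfun_apply (S (t - \<tau>))) (\<Psi> \<tau> \<omega>)) X"
  shows "(\<integral>\<^sup>+\<omega>. ennreal ((norm (stoch_convolution M F Q I e \<beta> S \<Psi> t \<omega>))\<^sup>2) \<partial>M) \<le>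
    4 * (ennreal (c\<^sup>2) * (\<integral>\<^sup>+\<omega>. (\<integral>\<^sup>+\<tau>\<in>{0..T}. ennreal ((L20_norm Q (\<Psi> \<tau> \<omega>))\<^sup>2) \<partial>lborel) \<partial>M))"
proof -
  let ?\<Phi> = "\<lambda>\<tau> \<omega>. compose (U0 Q) (blinfun_apply (S (t - \<tau>))) (\<Psi> \<tau> \<omega>)"
  have pred: "predictable_process M F T (L20_borel Q) \<Psi>" using \<Psi> by (simp add: N2_def)
  have T: "0 \<le> T" using t by simp
  have "(\<integral>\<^sup>+\<omega>. ennreal ((norm (stoch_convolution M F Q I e \<beta> S \<Psi> t \<omega>))\<^sup>2) \<partial>M) \<le>
      4 * (\<integral>\<^sup>+\<omega>. (\<integral>\<^sup>+\<tau>\<in>{0..t}. ennreal ((L20_norm Q (?\<Phi> \<tau> \<omega>))\<^sup>2) \<partial>lborel) \<partial>M)"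
    unfolding stoch_convolution_def stoch_integral_def
    by (rule has_stoch_integral_bound[OF someI_ex[OF ex]]) (use t in simp)
  also have "(\<integral>\<^sup>+\<omega>. (\<integral>\<^sup>+\<tau>\<in>{0..t}. ennreal ((L20_norm Q (?\<Phi> \<tau> \<omega>))\<^sup>2) \<partial>lborel) \<partial>M) \<le>
      ennreal (c\<^sup>2) * (\<integral>\<^sup>+\<omega>. (\<integral>\<^sup>+\<tau>\<in>{0..T}. ennreal ((L20_norm Q (\<Psi> \<tau> \<omega>))\<^sup>2) \<partial>lborel) \<partial>M)"
  proof -
    define b where "b \<tau> \<omega> = indicat_real {0..T} \<tau> *\<^sub>R L20_norm Q (\<Psi> \<tau> \<omega>)" for \<tau> \<omega>
    have b_meas[measurable]: "(\<lambda>(\<tau>, \<omega>). b \<tau> \<omega>) \<in> borel_measurable (lborel \<Otimes>\<^sub>M M)"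
      unfolding b_def
      by (rule predictable_process_indicator_measurable[OF F T pred dop.L20_norm_measurable])
    have "(\<integral>\<^sup>+\<omega>. (\<integral>\<^sup>+\<tau>\<in>{0..t}. ennreal ((L20_norm Q (?\<Phi> \<tau> \<omega>))\<^sup>2) \<partial>lborel) \<partial>M) \<le>
        (\<integral>\<^sup>+\<omega>. \<integral>\<^sup>+\<tau>. ennreal (c\<^sup>2) * ennreal ((b \<tau> \<omega>)\<^sup>2) \<partial>lborel \<partial>M)"
    proof (intro nn_integral_mono)
      fix \<omega> \<tau> assume \<omega>: "\<omega> \<in> space M"
      show "ennreal ((L20_norm Q (?\<Phi> \<tau> \<omega>))\<^sup>2) * indicator {0..t} \<tau> \<le> ennreal (c\<^sup>2) * ennreal ((b \<tau> \<omega>)\<^sup>2)"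
      proof (cases "\<tau> \<in> {0..t}")
        case True
        then have \<tau>: "\<tau> \<in> {0..T}" "t - \<tau> \<in> {0..T}" using t by auto
        have "\<Psi> \<tau> \<omega> \<in> L20 Q"
          using predictable_process_space[OF F pred \<tau>(1) \<omega>] by (simp add: dop.L20_borel_space)
        then have "(L20_norm Q (?\<Phi> \<tau> \<omega>))\<^sup>2 \<le> c\<^sup>2 * (L20_norm Q (\<Psi> \<tau> \<omega>))\<^sup>2"
          by (rule dop.L20_norm_compose_le[OF _ S[OF \<tau>(2)]])
        then show ?thesis
          using True \<tau>(1) by (simp add: b_def ennreal_leI flip: ennreal_mult)
      qed simp
    qed
    also have "\<dots> = ennreal (c\<^sup>2) * (\<integral>\<^sup>+\<omega>. \<integral>\<^sup>+\<tau>. ennreal ((b \<tau> \<omega>)\<^sup>2) \<partial>lborel \<partial>M)"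
      by (subst nn_integral_cmult[symmetric], measurable) (intro nn_integral_cong, simp add: nn_integral_cmult)
    also have "(\<integral>\<^sup>+\<omega>. \<integral>\<^sup>+\<tau>. ennreal ((b \<tau> \<omega>)\<^sup>2) \<partial>lborel \<partial>M) =
        (\<integral>\<^sup>+\<omega>. (\<integral>\<^sup>+\<tau>\<in>{0..T}. ennreal ((L20_norm Q (\<Psi> \<tau> \<omega>))\<^sup>2) \<partial>lborel) \<partial>M)"
      by (intro nn_integral_cong) (simp add: b_def indicator_def)
    finally show ?thesis .
  qed
  finally show ?thesis by (simp add: mult_left_mono)
qed

text \<open>The second alternative of the hypothesis \<open>dich\<close> covers the times at which the integral does
  not exist: there \<open>stoch_integral\<close> is the same arbitrary function for all such times.\<close>

lemma AE_square_integrable_trajectories: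
  fixes V :: "real \<Rightarrow> 'w \<Rightarrow> 'h::{real_inner, second_countable_topology}"
  assumes "prob_space M"
    and V: "(\<lambda>(t, \<omega>). V t \<omega>) \<in> borel_measurable (lborel \<Otimes>\<^sub>M M)"
    and out: "\<And>t \<omega>. t \<notin> {0..T} \<Longrightarrow> V t \<omega> = 0"
    and Y: "Y \<in> borel_measurable M" and L: "L < \<infinity>"
    and dich: "\<And>t. t \<in> {0..T} \<Longrightarrow>
      (\<integral>\<^sup>+\<omega>. ennreal ((norm (V t \<omega>))\<^sup>2) \<partial>M) \<le> L \<or> (AE \<omega> in M. V t \<omega> = Y \<omega>)"
  shows "AE \<omega> in M. integrable lborel (\<lambda>t. (norm (V t \<omega>))\<^sup>2)"
proof -
  interpret prob_space M by fact
  interpret pair_sigma_finite lborel M ..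
  note [measurable] = V Y
  \<comment> \<open>\<open>h t = 0\<close> holds exactly when the second alternative of
    \<open>dich\<close> does, and this condition is measurable in \<open>t\<close>.\<close>
  define h where "h t = (\<integral>\<^sup>+\<omega>. ennreal (norm (V t \<omega> - Y \<omega>)) \<partial>M)" for t
  have h[measurable]: "h \<in> borel_measurable lborel"
    unfolding h_def by measurable
  \<comment> \<open>\<open>f\<close> carries the times at which \<open>dich\<close> must supply the
    moment bound. At the other times, \<open>g\<close> carries the deviation from \<open>Y\<close>,
    which has integral zero. Tonelli's theorem applies to each separately.\<close>
  define f where "f t \<omega> = (if h t = 0 then 0 else ennreal ((norm (V t \<omega>))\<^sup>2))" for t \<omega>
  define g where "g t \<omega> = (if h t = 0 then ennreal ((norm (V t \<omega> - Y \<omega>))\<^sup>2) else 0)" for t \<omega>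
  have f[measurable]: "case_prod f \<in> borel_measurable (lborel \<Otimes>\<^sub>M M)"
    unfolding f_def by measurable
  have g[measurable]: "case_prod g \<in> borel_measurable (lborel \<Otimes>\<^sub>M M)"
    unfolding g_def by measurable
  have f_le: "(\<integral>\<^sup>+\<omega>. f t \<omega> \<partial>M) \<le> L * indicator {0..T} t" for t
  proof (cases "t \<in> {0..T} \<and> h t \<noteq> 0")
    case True
    have "\<not> (AE \<omega> in M. V t \<omega> = Y \<omega>)"
    proof
      assume "AE \<omega> in M. V t \<omega> = Y \<omega>"
      then have "AE \<omega> in M. ennreal (norm (V t \<omega> - Y \<omega>)) = 0" by eventually_elim simp
      then have "h t = 0" unfolding h_def by (subst nn_integral_0_iff_AE) auto
      then show False using True by simp
    qed
    then show ?thesis using dich[of t] True by (simp add: f_def)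
  next
    case False
    then have "f t \<omega> = 0" for \<omega>
      using out[of t \<omega>] by (auto simp: f_def)
    then show ?thesis by simp
  qed
  have "(\<integral>\<^sup>+\<omega>. \<integral>\<^sup>+t. f t \<omega> \<partial>lborel \<partial>M) = (\<integral>\<^sup>+t. \<integral>\<^sup>+\<omega>. f t \<omega> \<partial>M \<partial>lborel)"
    by (rule Fubini'[OF f])
  also have "\<dots> \<le> (\<integral>\<^sup>+t. L * indicator {0..T} t \<partial>lborel)"
    by (intro nn_integral_mono f_le)
  also have "\<dots> = L * emeasure lborel {0..T}"
    by (simp add: nn_integral_cmult_indicator)
  also have "\<dots> < \<infinity>"
    using L by (cases "0 \<le> T") (auto simp: ennreal_mult_less_top)
  finally have AE_f: "AE \<omega> in M. (\<integral>\<^sup>+t. f t \<omega> \<partial>lborel) \<noteq> \<infinity>"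
    by (intro nn_integral_PInf_AE) auto
  have g_0: "(\<integral>\<^sup>+\<omega>. g t \<omega> \<partial>M) = 0" for t
  proof (cases "h t = 0")
    case True
    then have "AE \<omega> in M. ennreal (norm (V t \<omega> - Y \<omega>)) = 0"
      unfolding h_def by (subst (asm) nn_integral_0_iff_AE) auto
    then have "AE \<omega> in M. g t \<omega> = 0" by eventually_elim (simp add: g_def)
    then show ?thesis by (subst nn_integral_0_iff_AE) auto
  qed (simp add: g_def)
  have "(\<integral>\<^sup>+\<omega>. \<integral>\<^sup>+t. g t \<omega> \<partial>lborel \<partial>M) = (\<integral>\<^sup>+t. \<integral>\<^sup>+\<omega>. g t \<omega> \<partial>M \<partial>lborel)"
    by (rule Fubini'[OF g])
  then have "(\<integral>\<^sup>+\<omega>. \<integral>\<^sup>+t. g t \<omega> \<partial>lborel \<partial>M) \<noteq> \<infinity>" by (simp add: g_0)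
  then have AE_g: "AE \<omega> in M. (\<integral>\<^sup>+t. g t \<omega> \<partial>lborel) \<noteq> \<infinity>"
    by (intro nn_integral_PInf_AE) auto
  from AE_f AE_g AE_space show ?thesis
  proof eventually_elim
    fix \<omega> assume fin: "(\<integral>\<^sup>+t. f t \<omega> \<partial>lborel) \<noteq> \<infinity>" "(\<integral>\<^sup>+t. g t \<omega> \<partial>lborel) \<noteq> \<infinity>"
      and \<omega>: "\<omega> \<in> space M"
    let ?y = "2 * ennreal ((norm (Y \<omega>))\<^sup>2)"
    \<comment> \<open>At times with \<open>h t = 0\<close> the trajectory is compared with
      \<open>Y \<omega>\<close>, a constant in time and thus square integrable on
      \<open>{0..T}\<close>.\<close>
    have le: "ennreal ((norm (V t \<omega>))\<^sup>2) \<le> f t \<omega> + (2 * g t \<omega> + ?y * indicator {0..T} t)" for t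
    proof (cases "t \<in> {0..T} \<and> h t = 0")
      case True
      have "norm (V t \<omega>) \<le> norm (V t \<omega> - Y \<omega>) + norm (Y \<omega>)"
        using norm_triangle_sub[of "V t \<omega>" "Y \<omega>"] by simp
      then have "ennreal ((norm (V t \<omega>))\<^sup>2) \<le> 2 * ennreal ((norm (V t \<omega> - Y \<omega>))\<^sup>2) + ?y"
        by (rule ennreal_square_le_double_sum) simp_all
      then show ?thesis using True by (simp add: f_def g_def)
    next
      case False
      then show ?thesis using out[of t \<omega>] by (cases "t \<in> {0..T}") (simp_all add: f_def)
    qed
    have [measurable]: "(\<lambda>t. f t \<omega>) \<in> borel_measurable lborel" "(\<lambda>t. g t \<omega>) \<in> borel_measurable lborel"
      "(\<lambda>t. V t \<omega>) \<in> borel_measurable lborel"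
      using measurable_Pair1[OF f \<omega>] measurable_Pair1[OF g \<omega>] measurable_Pair1[OF V \<omega>] by simp_all
    have "(\<integral>\<^sup>+t. ennreal ((norm (V t \<omega>))\<^sup>2) \<partial>lborel) \<le>
        (\<integral>\<^sup>+t. f t \<omega> + (2 * g t \<omega> + ?y * indicator {0..T} t) \<partial>lborel)"
      by (intro nn_integral_mono le)
    also have "\<dots> = (\<integral>\<^sup>+t. f t \<omega> \<partial>lborel) + (2 * (\<integral>\<^sup>+t. g t \<omega> \<partial>lborel) + ?y * emeasure lborel {0..T})"
      by (simp add: nn_integral_add nn_integral_cmult nn_integral_cmult_indicator)
    also have "\<dots> < \<infinity>"
      using fin by (cases "0 \<le> T") (auto simp: ennreal_mult_less_top less_top)
    finally show "integrable lborel (\<lambda>t. (norm (V t \<omega>))\<^sup>2)"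
      by (intro integrableI_bounded) auto
  qed
qed

theorem proposition3:
  fixes M :: "'w measure" and F :: "real \<Rightarrow> 'w measure"
    and Q :: "'u::{real_inner, banach, second_countable_topology} \<Rightarrow>\<^sub>L 'u"
    and I :: "nat set" and e :: "nat \<Rightarrow> 'u" and lam :: "nat \<Rightarrow> real"
    and \<beta> :: "nat \<Rightarrow> real \<Rightarrow> 'w \<Rightarrow> real"
    and DA :: "'h::{real_inner, banach, second_countable_topology} set" and A :: "'h \<Rightarrow> 'h"
    and a :: "real \<Rightarrow> real" and S :: "real \<Rightarrow> ('h \<Rightarrow>\<^sub>L 'h)"
    and T :: real and \<Psi> :: "real \<Rightarrow> 'w \<Rightarrow> 'u \<Rightarrow> 'h" and W\<Psi> :: "real \<Rightarrow> 'w \<Rightarrow> 'h"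
  assumes T: "T > 0"
    and M: "prob_space M" and F: "normal_filtration M F"
    and Q: "nonneg_op Q" and W: "cylindrical_wiener M F Q I e lam \<beta>"
    and A: "closed_densely_defined DA A"
    and a: "\<And>r. r > 0 \<Longrightarrow> a absolutely_integrable_on {0..r}"
    and S: "resolvent DA A a S"
    and \<Psi>: "\<Psi> \<in> N2 M F Q T"
    and W\<Psi>_predictable: "predictable_process M F T borel W\<Psi>"
    and W\<Psi>_version: "\<And>t. t \<in> {0..T} \<Longrightarrow>
      AE \<omega> in M. W\<Psi> t \<omega> = stoch_convolution M F Q I e \<beta> S \<Psi> t \<omega>"
  shows "AE \<omega> in M. set_integrable lborel {0..T} (\<lambda>t. (norm (W\<Psi> t \<omega>))\<^sup>2)"
proof -
  interpret cylindrical_noise M F Q I e lam \<beta>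
    by (intro cylindrical_noise.intro cylindrical_noise_axioms.intro M F Q W)
  obtain c where c: "\<And>t. t \<in> {0..T} \<Longrightarrow> norm (S t) \<le> c"
    using resolvent_bounded[OF S] by blast
  let ?\<Phi> = "\<lambda>t \<tau> \<omega>. compose (U0 Q) (blinfun_apply (S (t - \<tau>))) (\<Psi> \<tau> \<omega>)"
  define ex where "ex t \<longleftrightarrow> (\<exists>X. has_stoch_integral M F Q I e \<beta> t (?\<Phi> t) X)" for t
  define N where "N = (\<integral>\<^sup>+\<omega>. (\<integral>\<^sup>+\<tau>\<in>{0..T}. ennreal ((L20_norm Q (\<Psi> \<tau> \<omega>))\<^sup>2) \<partial>lborel) \<partial>M)"
  define V where "V t \<omega> = indicat_real {0..T} t *\<^sub>R W\<Psi> t \<omega>" for t \<omega>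
  have V_meas: "(\<lambda>(t, \<omega>). V t \<omega>) \<in> borel_measurable (lborel \<Otimes>\<^sub>M M)"
    unfolding V_def
    using predictable_process_indicator_measurable[OF F less_imp_le[OF T] W\<Psi>_predictable, of "\<lambda>x. x"] by simp
  have V_AE: "AE \<omega> in M. V t \<omega> = stoch_convolution M F Q I e \<beta> S \<Psi> t \<omega>" if "t \<in> {0..T}" for t
    using W\<Psi>_version[OF that] that by (simp add: V_def)
  have "N < \<infinity>" using \<Psi> by (simp add: N_def N2_def)
  then have L: "4 * (ennreal (c\<^sup>2) * N) < \<infinity>" by (simp add: ennreal_mult_less_top)
  have good: "(\<integral>\<^sup>+\<omega>. ennreal ((norm (V t \<omega>))\<^sup>2) \<partial>M) \<le> 4 * (ennreal (c\<^sup>2) * N)"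
    if t: "t \<in> {0..T}" and "ex t" for t
  proof -
    have "(\<integral>\<^sup>+\<omega>. ennreal ((norm (V t \<omega>))\<^sup>2) \<partial>M) =
        (\<integral>\<^sup>+\<omega>. ennreal ((norm (stoch_convolution M F Q I e \<beta> S \<Psi> t \<omega>))\<^sup>2) \<partial>M)"
      by (rule nn_integral_cong_AE) (use V_AE[OF t] in eventually_elim, simp)
    also have "\<dots> \<le> 4 * (ennreal (c\<^sup>2) * N)"
      unfolding N_def
      by (rule stoch_convolution_bound[OF \<Psi> c t]) (use \<open>ex t\<close> in \<open>simp_all add: ex_def\<close>)
    finally show ?thesis .
  qed
  have bad: "stoch_convolution M F Q I e \<beta> S \<Psi> t = (SOME X. False)" if "\<not> ex t" for t
    using that by (simp add: ex_def stoch_convolution_def stoch_integral_def)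
  \<comment> \<open>The common value \<open>SOME X. False\<close> need not be measurable. The
    process at one exceptional time \<open>r\<close> is measurable and agrees with it almost surely,
    so it takes its place.\<close>
  obtain Y where Y: "Y \<in> borel_measurable M"
    "\<And>t. t \<in> {0..T} \<Longrightarrow> \<not> ex t \<Longrightarrow> AE \<omega> in M. V t \<omega> = Y \<omega>"
  proof (cases "\<exists>t\<in>{0..T}. \<not> ex t")
    case True
    then obtain r where r: "r \<in> {0..T}" "\<not> ex r" by blast
    show ?thesis
    proof
      show "V r \<in> borel_measurable M"
        using measurable_compose_Pair1[OF _ V_meas, of r] by simp
      show "AE \<omega> in M. V t \<omega> = V r \<omega>" if "t \<in> {0..T}" "\<not> ex t" for t
        using V_AE[OF that(1)] V_AE[OF r(1)]
        by eventually_elim (simp add: bad[OF that(2)] bad[OF r(2)])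
    qed
  next
    case False
    then show ?thesis by (intro that[of "\<lambda>_. 0"]) auto
  qed
  have "AE \<omega> in M. integrable lborel (\<lambda>t. (norm (V t \<omega>))\<^sup>2)"
  proof (rule AE_square_integrable_trajectories[OF M V_meas _ Y(1) L])
    show "V t \<omega> = 0" if "t \<notin> {0..T}" for t \<omega> using that by (simp add: V_def)
    show "(\<integral>\<^sup>+\<omega>. ennreal ((norm (V t \<omega>))\<^sup>2) \<partial>M) \<le> 4 * (ennreal (c\<^sup>2) * N) \<or>
        (AE \<omega> in M. V t \<omega> = Y \<omega>)" if "t \<in> {0..T}" for t
      using good[OF that] Y(2)[OF that] by blast
  qed
  then show ?thesis
  proof eventually_elim
    fix \<omega> assume "integrable lborel (\<lambda>t. (norm (V t \<omega>))\<^sup>2)"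
    moreover have "(norm (V t \<omega>))\<^sup>2 = indicat_real {0..T} t *\<^sub>R (norm (W\<Psi> t \<omega>))\<^sup>2" for t
      by (simp add: V_def indicator_def)
    ultimately show "set_integrable lborel {0..T} (\<lambda>t. (norm (W\<Psi> t \<omega>))\<^sup>2)"
      by (simp add: set_integrable_def)
  qed
qed

end
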